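(* Let $V\neq\{0\}$ be a normed vector space and let $X\neq\{0\}$ be a Banach space, both over $\mathbb{K}$. Let $E$ be a Banach sequence space of $X$-valued sequences such that $c_{00}(X)\subset E$. If $$A_{V,E}:=\{u\colon V\rightarrow E : u\text{ is linear, continuous and non-injective}\}\neq\{0\},$$ then $A_{V,E}$ is $(1,\beta)$-spaceable in $\mathcal{L}(V;E)$, where $\beta=\max\{\mathfrak{c},\dim X\}$.
   Context: $\mathbb{K}$ denotes the scalar field ($\mathbb{R}$ or $\mathbb{C}$), $\mathfrak{c}$ the cardinality of the continuum, and $\dim$ the algebraic (Hamel) dimension. $\mathcal{L}(V;E)$ is the vector space of continuous linear operators from $V$ to $E$, endowed with the usual operator (sup) norm. $(\alpha,\beta)$-spaceability: let $\alpha,\beta,\lambda$ be cardinal numbers with $\alpha<\beta\leq\lambda$, and let $Z$ be a topological vector space with $\dim Z=\lambda$. A subset $A$ of $Z$ is called $(\alpha,\beta)$-spaceable (in $Z$) if for every linear subspace $W_\alpha\subset Z$ with $\dim W_\alpha=\alpha$ and $W_\alpha\subset A\cup\{0\}$ there is a closed linear subspace $W_\beta\subset Z$ with $\dim W_\beta=\beta$ and $W_\alpha\subset W_\beta\subset A\cup\{0\}$. Sequence spaces: for a Banach space $X$, $c_{00}(X)$ is the space of sequences in $X$ with only finitely many nonzero terms. A Banach sequence space of $X$-valued sequences is a vector space $E$ of sequences $(x_j)_{j=1}^\infty$ with $x_j\in X$ (with coordinatewise operations), endowed with a complete norm. *)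

theory Defs
  imports "HOL-Analysis.Analysis" "HOL-Library.Function_Algebras"
begin

unbundle cardinal_syntax
no_notation elt_set_eq (infix "=o" 50)  (* Set_Algebras; ambiguous with ordIso *)

text \<open>The scalar field is \<open>\<real>\<close> or \<open>\<complex>\<close>: the class axiom identifies it, as a normed real algebra,
  with one of these two subfields of \<open>\<complex>\<close>.\<close>

class real_or_complex = real_normed_field +
  assumes real_or_complex: "\<exists>\<phi> :: 'a \<Rightarrow> complex.
    (\<forall>a b. \<phi> (a + b) = \<phi> a + \<phi> b) \<and> (\<forall>r a. \<phi> (r *\<^sub>R a) = r *\<^sub>R \<phi> a) \<and>
    \<phi> 1 = 1 \<and> (\<forall>a b. \<phi> (a * b) = \<phi> a * \<phi> b) \<and> (\<forall>a. norm (\<phi> a) = norm a) \<and> (range \<phi> = \<real> \<or> range \<phi> = UNIV)"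

instance real :: real_or_complex
proof
  have "range complex_of_real = \<real>"
    by (simp add: Reals_def)
  then show "\<exists>\<phi> :: real \<Rightarrow> complex.
    (\<forall>a b. \<phi> (a + b) = \<phi> a + \<phi> b) \<and> (\<forall>r a. \<phi> (r *\<^sub>R a) = r *\<^sub>R \<phi> a) \<and>
    \<phi> 1 = 1 \<and> (\<forall>a b. \<phi> (a * b) = \<phi> a * \<phi> b) \<and> (\<forall>a. norm (\<phi> a) = norm a) \<and> (range \<phi> = \<real> \<or> range \<phi> = UNIV)"
    by (intro exI[of _ complex_of_real]) (auto simp: scaleR_conv_of_real)
qed

instance complex :: real_or_complex
  by standard (intro exI[of _ id], auto)

text \<open>A normed space over the scalar field \<open>'k\<close>. The type class supplies the group structure, the
  norm and its topology; its real scaling is the restriction of \<open>scale\<close> to the real scalars.\<close>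

locale normed_space_over = vector_space scale
  for scale :: "'k::real_or_complex \<Rightarrow> 'v::real_normed_vector \<Rightarrow> 'v" +
  assumes norm_scale: "norm (scale a v) = norm a * norm v"
    and scale_of_real: "scale (of_real r) v = r *\<^sub>R v"

text \<open>A norm \<open>N\<close> on a linear subspace \<open>S\<close> of an ambient vector space; the values of \<open>N\<close> outside
  \<open>S\<close> are irrelevant.\<close>

locale normed_subspace = vector_space scale
  for scale :: "'k::real_or_complex \<Rightarrow> 'z::ab_group_add \<Rightarrow> 'z" +
  fixes S :: "'z set" and N :: "'z \<Rightarrow> real"
  assumes subspace_S: "subspace S"
    and N_nonneg: "x \<in> S \<Longrightarrow> 0 \<le> N x"
    and N_eq_0: "x \<in> S \<Longrightarrow> N x = 0 \<longleftrightarrow> x = 0"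
    and N_triangle: "x \<in> S \<Longrightarrow> y \<in> S \<Longrightarrow> N (x + y) \<le> N x + N y"
    and N_scale: "x \<in> S \<Longrightarrow> N (scale a x) = norm a * N x"

text \<open>The locale \<open>Metric_space\<close> wants a symmetric nonnegative distance on the whole type, hence the
  default value outside \<open>S\<close>.\<close>

definition norm_dist :: "'z::ab_group_add set \<Rightarrow> ('z \<Rightarrow> real) \<Rightarrow> 'z \<Rightarrow> 'z \<Rightarrow> real" where
  "norm_dist S N x y = (if x \<in> S \<and> y \<in> S then N (x - y) else 0)"

definition norm_topology :: "'z::ab_group_add set \<Rightarrow> ('z \<Rightarrow> real) \<Rightarrow> 'z topology" where
  "norm_topology S N = Metric_space.mtopology S (norm_dist S N)"

lemma (in normed_subspace) Metric_space_norm_dist: "Metric_space S (norm_dist S N)"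
proof
  fix x y z
  have minus: "N (y - x) = N (x - y)" if "x \<in> S" "y \<in> S" for x y
    using N_scale[of "x - y" "-1"] subspace_diff[OF subspace_S that] by simp
  show "0 \<le> norm_dist S N x y"
    using N_nonneg subspace_diff[OF subspace_S] by (simp add: norm_dist_def)
  show "norm_dist S N x y = norm_dist S N y x"
    using minus by (simp add: norm_dist_def)
  show "norm_dist S N x y = 0 \<longleftrightarrow> x = y" if "x \<in> S" "y \<in> S"
    using that N_eq_0[OF subspace_diff[OF subspace_S that]] by (simp add: norm_dist_def)
  show "norm_dist S N x z \<le> norm_dist S N x y + norm_dist S N y z"
    if "x \<in> S" "y \<in> S" "z \<in> S"
    using that N_triangle[of "x - y" "y - z"] subspace_diff[OF subspace_S]
    by (simp add: norm_dist_def)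
qed

lemma (in normed_subspace) topspace_norm_topology: "topspace (norm_topology S N) = S"
  unfolding norm_topology_def
  by (rule Metric_space.topspace_mtopology[OF Metric_space_norm_dist])

definition scale_fun :: "('k \<Rightarrow> 'b \<Rightarrow> 'b) \<Rightarrow> 'k \<Rightarrow> ('a \<Rightarrow> 'b) \<Rightarrow> 'a \<Rightarrow> 'b" where
  "scale_fun scl a f = (\<lambda>t. scl a (f t))"

definition c00 :: "(nat \<Rightarrow> 'x::zero) set" where
  "c00 = {x. finite {j. x j \<noteq> 0}}"

locale banach_sequence_space = normed_subspace "scale_fun scaleX" E normE
  for scaleX :: "'k::real_or_complex \<Rightarrow> 'x::banach \<Rightarrow> 'x"
    and E :: "(nat \<Rightarrow> 'x) set" and normE :: "(nat \<Rightarrow> 'x) \<Rightarrow> real" +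
  assumes normed_X: "normed_space_over scaleX"
    and complete_E: "Metric_space.mcomplete E (norm_dist E normE)"

definition cont_lin_ops ::
  "('k::real_or_complex \<Rightarrow> 'v::real_normed_vector \<Rightarrow> 'v) \<Rightarrow> ('k \<Rightarrow> 'z::ab_group_add \<Rightarrow> 'z) \<Rightarrow>
   'z set \<Rightarrow> ('z \<Rightarrow> real) \<Rightarrow> ('v \<Rightarrow> 'z) set" where
  "cont_lin_ops scaleV scaleZ S N =
     {u. range u \<subseteq> S \<and> Vector_Spaces.linear scaleV scaleZ u \<and>
         continuous_map euclidean (norm_topology S N) u}"

definition op_norm :: "('z \<Rightarrow> real) \<Rightarrow> ('v::real_normed_vector \<Rightarrow> 'z) \<Rightarrow> real" where
  "op_norm N u = (SUP v\<in>{v. norm v \<le> 1}. N (u v))"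

definition noninj_ops ::
  "('k::real_or_complex \<Rightarrow> 'v::real_normed_vector \<Rightarrow> 'v) \<Rightarrow> ('k \<Rightarrow> 'z::ab_group_add \<Rightarrow> 'z) \<Rightarrow>
   'z set \<Rightarrow> ('z \<Rightarrow> real) \<Rightarrow> ('v \<Rightarrow> 'z) set" where
  "noninj_ops scaleV scaleZ S N = {u \<in> cont_lin_ops scaleV scaleZ S N. \<not> inj u}"

text \<open>The Hamel dimension as a cardinal (the library's \<open>dim\<close> is a natural number, with value 0 for
  infinite-dimensional spaces). It is meant for linear subspaces \<open>W\<close>.\<close>

definition hamel_dim :: "('k::field \<Rightarrow> 'z::ab_group_add \<Rightarrow> 'z) \<Rightarrow> 'z set \<Rightarrow> 'z rel" where
  "hamel_dim scl W =
     |SOME B. B \<subseteq> W \<and> \<not> module.dependent scl B \<and> module.span scl B = W|"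

lemma (in vector_space) hamel_dim_basis:
  assumes "subspace W"
  obtains B where "B \<subseteq> W" "independent B" "span B = W" "hamel_dim scale W = |B|"
proof -
  let ?P = "\<lambda>B. B \<subseteq> W \<and> independent B \<and> span B = W"
  obtain B where "B \<subseteq> W" "independent B" "W \<subseteq> span B"
    using maximal_independent_subset[of W] by blast
  moreover from this assms have "span B = W"
    using span_minimal by blast
  ultimately have "\<exists>B. ?P B" by blast
  then have "?P (SOME B. ?P B)" by (rule someI_ex)
  then show thesis using that unfolding hamel_dim_def by blast
qed

text \<open>Cardinals are represented by cardinal orders on arbitrary types, so the maximum of two of
  them is placed on a sum type.\<close>

definition card_max :: "'a rel \<Rightarrow> 'b rel \<Rightarrow> ('a + 'b) rel" where
  "card_max r s = (if r \<le>o s then |Inr ` Field s| else |Inl ` Field r| )"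

lemma card_max_right:
  assumes "Card_order s" and "r \<le>o s"
  shows "card_max r s =o s"
proof -
  have "bij_betw Inr (Field s) (Inr ` Field s)" by (simp add: bij_betw_def)
  then have "|Inr ` Field s| =o |Field s|" by (intro ordIso_symmetric[OF card_of_ordIsoI])
  also have "|Field s| =o s" by (rule card_of_Field_ordIso) fact
  finally show ?thesis using assms(2) by (simp add: card_max_def)
qed

lemma card_max_left:
  assumes r: "Card_order r" and s: "Card_order s" and "s \<le>o r"
  shows "card_max r s =o r"
proof (cases "r \<le>o s")
  case True
  then have "s =o r" using assms(3) by (simp add: ordIso_iff_ordLeq)
  then show ?thesis using card_max_right[OF s True] ordIso_transitive by blast
next
  case False
  have "bij_betw Inl (Field r) (Inl ` Field r)" by (simp add: bij_betw_def)
  then have "|Inl ` Field r| =o |Field r|" by (intro ordIso_symmetric[OF card_of_ordIsoI])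
  also have "|Field r| =o r" by (rule card_of_Field_ordIso) fact
  finally show ?thesis using False by (simp add: card_max_def)
qed

text \<open>\<open>(\<alpha>, \<beta>)\<close>-spaceability of \<open>A\<close> in the topological vector space with underlying vector space
  \<open>Z\<close> and topology \<open>T\<close>. The standing requirement \<open>\<alpha> < \<beta> \<le> dim Z\<close> is part of the definition.\<close>

definition spaceable ::
  "('k::field \<Rightarrow> 'z::ab_group_add \<Rightarrow> 'z) \<Rightarrow> 'z set \<Rightarrow> 'z topology \<Rightarrow> 'a rel \<Rightarrow> 'b rel \<Rightarrow> 'z set \<Rightarrow> bool"
where
  "spaceable scl Z T \<alpha> \<beta> A \<longleftrightarrow>
     Card_order \<alpha> \<and> Card_order \<beta> \<and> \<alpha> <o \<beta> \<and> \<beta> \<le>o hamel_dim scl Z \<and> A \<subseteq> Z \<and>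
     (\<forall>W. module.subspace scl W \<and> W \<subseteq> Z \<and> hamel_dim scl W =o \<alpha> \<and> W \<subseteq> A \<union> {0} \<longrightarrow>
       (\<exists>W'. module.subspace scl W' \<and> W' \<subseteq> Z \<and> closedin T W' \<and> hamel_dim scl W' =o \<beta> \<and>
             W \<subseteq> W' \<and> W' \<subseteq> A \<union> {0}))"

text \<open>The operators with \<open>op_norm\<close> form a normed space, so that \<open>norm_topology\<close> applies to them.\<close>

lemma vector_space_scale_fun:
  assumes "vector_space scl" shows "vector_space (scale_fun scl)"
proof -
  interpret vector_space scl by fact
  show ?thesis
    by unfold_locales (auto simp: scale_fun_def fun_eq_iff algebra_simps)
qed

lemma cont_lin_ops_bounded:
  assumes V: "normed_space_over scaleV" and Z: "normed_subspace scaleZ S N"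
    and u: "u \<in> cont_lin_ops scaleV scaleZ S N"
  obtains C where "\<And>v. N (u v) \<le> C * norm v"
proof -
  interpret V: normed_space_over scaleV by fact
  interpret Z: normed_subspace scaleZ S N by fact
  interpret M: Metric_space S "norm_dist S N" by (rule Z.Metric_space_norm_dist)
  interpret u: Vector_Spaces.linear scaleV scaleZ u
    using u by (simp add: cont_lin_ops_def)
  have uS: "u v \<in> S" for v using u by (auto simp: cont_lin_ops_def)
  have "continuous_map euclidean M.mtopology u"
    using u by (simp add: cont_lin_ops_def norm_topology_def)
  moreover have "openin M.mtopology (M.mball 0 1)" by (rule M.openin_mball)
  ultimately have "open {v. u v \<in> M.mball 0 1}"
    unfolding continuous_map_def by auto
  moreover have "0 \<in> S" using Z.subspace_0[OF Z.subspace_S] .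
  moreover from this have "0 \<in> {v. u v \<in> M.mball 0 1}" by (simp add: u.zero)
  ultimately obtain d where d: "d > 0" "ball 0 d \<subseteq> {v. u v \<in> M.mball 0 1}"
    by (meson open_contains_ball)
  have dist0: "norm_dist S N 0 x = N x" if "x \<in> S" for x
    using that \<open>0 \<in> S\<close> M.commute[of 0 x] by (simp add: norm_dist_def)
  have small: "N (u v) \<le> 1" if "norm v < d" for v
    using d(2) that uS[of v] dist0[of "u v"] by (force simp: subset_iff)
  show thesis
  proof (rule that)
    fix v
    show "N (u v) \<le> (2 / d) * norm v"
    proof (cases "v = 0")
      case True
      then show ?thesis using Z.N_eq_0[OF \<open>0 \<in> S\<close>] by (simp add: u.zero)
    next
      case False
      define t where "t = d / (2 * norm v)"
      have t: "t > 0" using d False by (simp add: t_def)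
      have "norm (scaleV (of_real t) v) = d / 2"
        using t False by (simp add: V.norm_scale) (simp add: t_def)
      then have "N (u (scaleV (of_real t) v)) \<le> 1" using small d by simp
      then have "t * N (u v) \<le> 1"
        using t by (simp add: u.scale Z.N_scale uS)
      then show ?thesis using t d False by (simp add: t_def field_simps)
    qed
  qed
qed

lemma normed_subspace_cont_lin_ops:
  fixes scaleV :: "'k::real_or_complex \<Rightarrow> 'v::real_normed_vector \<Rightarrow> 'v"
    and scaleZ :: "'k \<Rightarrow> 'z::ab_group_add \<Rightarrow> 'z"
  assumes V: "normed_space_over scaleV" and Z: "normed_subspace scaleZ S N"
  shows "normed_subspace (scale_fun scaleZ) (cont_lin_ops scaleV scaleZ S N) (op_norm N)"
proof -
  interpret V: normed_space_over scaleV by fact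
  interpret Z: normed_subspace scaleZ S N by fact
  interpret M: Metric_space S "norm_dist S N" by (rule Z.Metric_space_norm_dist)
  interpret F: vector_space "scale_fun scaleZ :: 'k \<Rightarrow> ('v \<Rightarrow> 'z) \<Rightarrow> 'v \<Rightarrow> 'z"
    by (rule vector_space_scale_fun) (rule Z.vector_space_axioms)
  let ?L = "cont_lin_ops scaleV scaleZ S N"
  let ?B = "{v :: 'v. norm v \<le> 1}"
  have S0: "0 \<in> S" using Z.subspace_0[OF Z.subspace_S] .
  have N0: "N 0 = 0" using Z.N_eq_0[OF S0] by simp
  have memI: "u \<in> ?L"
    if lin: "Vector_Spaces.linear scaleV scaleZ u" and r: "\<And>v. u v \<in> S"
      and C: "\<And>v. N (u v) \<le> C * norm v" for u C
  proof -
    interpret u: Vector_Spaces.linear scaleV scaleZ u by fact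
    have "openin euclidean {v \<in> topspace euclidean. u v \<in> U}" if U: "openin M.mtopology U" for U
    proof -
      have "\<exists>e>0. ball v e \<subseteq> {v. u v \<in> U}" if v: "u v \<in> U" for v
      proof -
        obtain e where e: "e > 0" "M.mball (u v) e \<subseteq> U"
          using U v unfolding M.openin_mtopology by blast
        define D where "D = max C 1"
        have "D > 0" by (simp add: D_def)
        have "u w \<in> U" if w: "norm (v - w) < e / D" for w
        proof -
          have "N (u v - u w) \<le> C * norm (v - w)" using C[of "v - w"] by (simp add: u.diff)
          also have "\<dots> \<le> D * norm (v - w)" by (intro mult_right_mono) (auto simp: D_def)
          also have "\<dots> < e" using w \<open>D > 0\<close> by (simp add: field_simps)
          finally show ?thesis using e(2) r by (force simp: norm_dist_def subset_iff)
        qed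
        then show ?thesis using e \<open>D > 0\<close>
          by (intro exI[of _ "e / D"]) (auto simp: dist_norm)
      qed
      then show ?thesis by (simp add: open_contains_ball)
    qed
    then have "continuous_map euclidean M.mtopology u"
      using r by (auto simp: continuous_map_def)
    then show ?thesis using lin r by (auto simp: cont_lin_ops_def norm_topology_def)
  qed
  have lin: "Vector_Spaces.linear scaleV scaleZ u" and r: "u v \<in> S" if "u \<in> ?L" for u v
    using that by (auto simp: cont_lin_ops_def)
  have bdd: "bdd_above ((\<lambda>v. N (u v)) ` ?B)" if u: "u \<in> ?L" for u
  proof -
    obtain C where C: "\<And>v. N (u v) \<le> C * norm v"
      using cont_lin_ops_bounded[OF V Z u] by blast
    have "N (u v) \<le> max C 0" if "norm v \<le> 1" for v
    proof -
      have "N (u v) \<le> C * norm v" by fact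
      also have "\<dots> \<le> max C 0 * norm v" by (intro mult_right_mono) auto
      also have "\<dots> \<le> max C 0 * 1" using that by (intro mult_left_mono) auto
      finally show ?thesis by simp
    qed
    then show ?thesis by (auto simp: bdd_above_def)
  qed
  have upper: "N (u v) \<le> op_norm N u" if "u \<in> ?L" "norm v \<le> 1" for u v
    unfolding op_norm_def using bdd that by (intro cSUP_upper) auto
  have least: "op_norm N u \<le> C" if "\<And>v. norm v \<le> 1 \<Longrightarrow> N (u v) \<le> C" for u :: "'v \<Rightarrow> _" and C
    unfolding op_norm_def using that by (intro cSUP_least) (auto intro: exI[of _ 0])
  have zero: "u 0 = 0" if "u \<in> ?L" for u
    using lin[OF that] by (simp add: Vector_Spaces.linear_iff_module_hom module_hom.zero)
  have add_mem: "u + w \<in> ?L" if u: "u \<in> ?L" and w: "w \<in> ?L" for u w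
  proof -
    obtain C D where C: "\<And>v. N (u v) \<le> C * norm v" and D: "\<And>v. N (w v) \<le> D * norm v"
      using cont_lin_ops_bounded[OF V Z u] cont_lin_ops_bounded[OF V Z w] by metis
    show ?thesis
    proof (rule memI[of _ "C + D"])
      interpret u: Vector_Spaces.linear scaleV scaleZ u using lin[OF u] .
      interpret w: Vector_Spaces.linear scaleV scaleZ w using lin[OF w] .
      show "Vector_Spaces.linear scaleV scaleZ (u + w)"
        by unfold_locales (auto simp: u.add w.add u.scale w.scale Z.scale_right_distrib)
      show "(u + w) v \<in> S" for v
        using Z.subspace_add[OF Z.subspace_S] r u w by simp
      show "N ((u + w) v) \<le> (C + D) * norm v" for v
        using Z.N_triangle[OF r[OF u] r[OF w], of v v] C[of v] D[of v] by (simp add: algebra_simps)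
    qed
  qed
  have scale_mem: "scale_fun scaleZ a u \<in> ?L" if u: "u \<in> ?L" for a u
  proof -
    obtain C where C: "\<And>v. N (u v) \<le> C * norm v" using cont_lin_ops_bounded[OF V Z u] by blast
    show ?thesis
    proof (rule memI[of _ "norm a * C"])
      interpret u: Vector_Spaces.linear scaleV scaleZ u using lin[OF u] .
      show "Vector_Spaces.linear scaleV scaleZ (scale_fun scaleZ a u)"
        by unfold_locales (auto simp: scale_fun_def u.add u.scale Z.scale_right_distrib mult.commute)
      show "scale_fun scaleZ a u v \<in> S" for v
        using Z.subspace_scale[OF Z.subspace_S] r u by (simp add: scale_fun_def)
      show "N (scale_fun scaleZ a u v) \<le> norm a * C * norm v" for v
        using mult_left_mono[OF C[of v], of "norm a"] Z.N_scale[OF r[OF u]]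
        by (simp add: scale_fun_def mult.assoc)
    qed
  qed
  have zero_mem: "0 \<in> ?L"
  proof (rule memI[of _ 0])
    show "Vector_Spaces.linear scaleV scaleZ 0" by unfold_locales auto
  qed (auto simp: S0 N0)
  have nonneg: "0 \<le> op_norm N u" if "u \<in> ?L" for u
    using upper[OF that, of 0] by (simp add: zero[OF that] N0)
  have scale_le: "op_norm N (scale_fun scaleZ a u) \<le> norm a * op_norm N u" if u: "u \<in> ?L" for a u
    by (rule least) (simp add: scale_fun_def Z.N_scale[OF r[OF u]] mult_left_mono upper[OF u])
  show ?thesis
  proof unfold_locales
    show "F.subspace ?L"
      using zero_mem add_mem scale_mem by (simp add: F.subspace_def)
    show "0 \<le> op_norm N u" if "u \<in> ?L" for u using nonneg[OF that] .
    show "op_norm N u = 0 \<longleftrightarrow> u = 0" if u: "u \<in> ?L" for u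
    proof
      assume 0: "op_norm N u = 0"
      interpret u: Vector_Spaces.linear scaleV scaleZ u using lin[OF u] .
      have "u v = 0" for v
      proof (cases "v = 0")
        case False
        define t where "t = 1 / norm v"
        define w where "w = scaleV (of_real t) v"
        have t: "t > 0" using False by (simp add: t_def)
        then have "norm w = t * norm v" by (simp add: w_def V.norm_scale)
        then have "norm w = 1" using False by (simp add: t_def)
        then have "N (u w) = 0" using upper[OF u, of w] 0 Z.N_nonneg[OF r[OF u], of w] by simp
        then have "t * N (u v) = 0"
          using t by (simp add: w_def u.scale Z.N_scale[OF r[OF u]])
        then show ?thesis using t Z.N_eq_0[OF r[OF u]] by simp
      qed (simp add: u.zero)
      then show "u = 0" by (simp add: fun_eq_iff)
    next
      assume "u = 0"
      then show "op_norm N u = 0"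
        using least[of u 0] nonneg[OF u] by (simp add: N0)
    qed
    show "op_norm N (u + w) \<le> op_norm N u + op_norm N w" if u: "u \<in> ?L" and w: "w \<in> ?L" for u w
    proof (rule least)
      fix v :: 'v assume "norm v \<le> 1"
      then show "N ((u + w) v) \<le> op_norm N u + op_norm N w"
        using Z.N_triangle[OF r[OF u] r[OF w], of v v] upper[OF u] upper[OF w]
        by (simp add: order_trans add_mono)
    qed
    show "op_norm N (scale_fun scaleZ a u) = norm a * op_norm N u" if u: "u \<in> ?L" for a u
    proof (cases "a = 0")
      case True
      have "op_norm N (scale_fun scaleZ a u) \<le> 0" using scale_le[OF u, of a] True by simp
      then show ?thesis using nonneg[OF scale_mem[OF u], of a] True by simp
    next
      case False
      have "u = scale_fun scaleZ (inverse a) (scale_fun scaleZ a u)"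
        using False by (simp add: scale_fun_def)
      then have "op_norm N u \<le> norm (inverse a) * op_norm N (scale_fun scaleZ a u)"
        using scale_le[OF scale_mem[OF u], of "inverse a" a] by simp
      then have "norm a * op_norm N u \<le> op_norm N (scale_fun scaleZ a u)"
        using False by (simp add: nonzero_norm_inverse) (simp add: divide_simps mult.commute)
      then show ?thesis using scale_le[OF u, of a] by simp
    qed
  qed
qed

end

theory Submission
  imports Defs
begin

text \<open>
  Let \<open>u \<noteq> 0\<close> be a continuous operator with \<open>u v0 = 0\<close> for some \<open>v0 \<noteq> 0\<close>. Hahn--Banach gives a
  continuous functional \<open>\<psi>\<close> on \<open>E\<close> with \<open>\<psi> \<circ> u \<noteq> 0\<close>; put \<open>\<phi> = \<psi> \<circ> u\<close>. Every operator
  \<open>v \<mapsto> \<phi> v \<cdot> y + a \<cdot> u v\<close> with \<open>y \<in> E\<close> and \<open>a\<close> a scalar kills \<open>v0\<close>, because \<open>\<phi>\<close> vanishes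
  wherever \<open>u\<close> does. So these operators form a linear space of non-injective operators that contains
  \<open>u\<close>. It is closed: a suitable vector \<open>y\<close> and scalar \<open>a\<close> can be read off continuously from the values
  of the operator at two points, so that membership is a family of closed conditions
  (\<open>rank_one_perturbations\<close>).

  It remains to see that the Hamel dimension of this space is exactly \<open>\<beta> = max {c, dim X}\<close>, where
  \<open>c\<close> is the cardinality of the continuum. It contains
  a linear copy of \<open>E\<close>, and it has at most \<open>c \<cdot> \<bar>E\<bar>\<close> elements, so it suffices to prove
  \<open>\<bar>E\<bar> \<le> \<beta> \<le> dim E\<close>.

  For the upper bound, \<open>E\<close> is a set of sequences in \<open>X\<close>, and a Banach space has as many elements as
  sequences of elements (\<open>inj_sequences_into_banach\<close>): a point is determined by its roundings to finite
  precision, and countably many such roundings can be stored in one point as the terms of a rapidly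
  converging series. Finally \<open>\<bar>X\<bar> \<le> \<beta>\<close>, as every vector is a finite linear combination of basis
  vectors.

  For the lower bound, \<open>E\<close> contains a copy of \<open>X\<close>, and \<open>E\<close> is an infinite-dimensional Banach space.
  By a theorem of Mackey its Hamel dimension is at least \<open>c\<close> (\<open>continuum_le_hamel_dim\<close>): for unit vectors
  \<open>x\<^sub>n\<close> in triangular position with respect to continuous functionals, the sums of the power
  series \<open>\<Sum>n. t\<^sup>n x\<^sub>n\<close> with \<open>0 < t < 1\<close> are linearly independent, by a Vandermonde argument.

  The norm of \<open>E\<close> need not be related to the norm of \<open>X\<close>, nor need the coordinate functionals of \<open>E\<close>
  be continuous. Therefore the copies of \<open>X\<close> and \<open>c\<^sub>0\<^sub>0(X)\<close> in \<open>E\<close> are used only algebraically, and the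
  functionals come from Hahn--Banach.
\<close>

section \<open>The scalar field\<close>

text \<open>Both the passage from real to general scalars in Hahn--Banach and the count of scalars rest on this
  dichotomy: the field is either \<open>\<real>\<close>, or it has an imaginary
  unit of norm one and every scalar splits into a real and an imaginary part.\<close>

lemma real_or_complex_cases:
  obtains (real) "\<And>a :: 'k::real_or_complex. \<exists>r. a = of_real r"
  | (complex) i :: "'k::real_or_complex"
    where "i * i = -1" "norm i = 1" "\<And>a. \<exists>r s. a = of_real r + i * of_real s"
      "\<And>r s. of_real r + i * of_real s = 0 \<Longrightarrow> r = 0"
proof -
  obtain \<phi> :: "'k \<Rightarrow> complex" where add: "\<And>a b. \<phi> (a + b) = \<phi> a + \<phi> b"
    and scl: "\<And>r a. \<phi> (r *\<^sub>R a) = r *\<^sub>R \<phi> a" and one: "\<phi> 1 = 1"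
    and mult: "\<And>a b. \<phi> (a * b) = \<phi> a * \<phi> b" and nrm: "\<And>a. norm (\<phi> a) = norm a"
    and rng: "range \<phi> = \<real> \<or> range \<phi> = UNIV"
    using real_or_complex by metis
  have of_real: "\<phi> (of_real r) = of_real r" for r
    by (simp add: of_real_def scl one)
  have minus: "\<phi> (- a) = - \<phi> a" for a
    using scl[of "-1" a] by simp
  have inj: "a = b" if "\<phi> a = \<phi> b" for a b :: 'k
    using nrm[of "a - b"] add[of a "- b"] that by (simp add: minus)
  show thesis
  proof (cases "range \<phi> = \<real>")
    case True
    have "\<exists>r. a = of_real r" for a :: 'k
    proof -
      have "\<phi> a \<in> \<real>" using True by auto
      then obtain r where "\<phi> a = of_real r" by (auto elim: Reals_cases)
      then show ?thesis using inj[of a "of_real r"] of_real by auto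
    qed
    then show thesis by (rule real)
  next
    case False
    then obtain i where i: "\<phi> i = \<i>" using rng by (metis UNIV_I imageE)
    show thesis
    proof (rule complex[of i])
      show "i * i = -1" by (rule inj) (simp add: mult i minus one)
      show "norm i = 1" using nrm[of i] by (simp add: i)
      show "\<exists>r s. a = of_real r + i * of_real s" for a
        by (intro exI[of _ "Re (\<phi> a)"] exI[of _ "Im (\<phi> a)"] inj)
          (simp add: add mult of_real i complex_eq[symmetric])
      show "r = 0" if "of_real r + i * of_real s = 0" for r s
      proof -
        have "of_real r + \<i> * of_real s = \<phi> (of_real r + i * of_real s)"
          by (simp add: add mult i of_real)
        also have "\<dots> = 0" using nrm[of 0] that by simp
        finally show ?thesis by (simp add: complex_eq_iff)
      qed
    qed
  qed
qed

lemma card_of_scalars: "|UNIV :: 'k::real_or_complex set| \<le>o |UNIV :: real set|"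
proof -
  have "\<exists>g :: real \<times> real \<Rightarrow> 'k. surj g"
  proof (cases rule: real_or_complex_cases[where 'k = 'k])
    case real
    then have "surj (\<lambda>p :: real \<times> real. of_real (fst p) :: 'k)"
      by (auto simp: surj_def)
    then show ?thesis by blast
  next
    case (complex i)
    then have "surj (\<lambda>p :: real \<times> real. of_real (fst p) + i * of_real (snd p))"
      by (auto simp: surj_def)
    then show ?thesis by blast
  qed
  then obtain g :: "real \<times> real \<Rightarrow> 'k" where "surj g" ..
  then have "|UNIV :: 'k set| \<le>o |UNIV :: (real \<times> real) set|"
    using card_of_image[of g UNIV] by simp
  also have "|UNIV :: (real \<times> real) set| =o |UNIV :: real set|"
    using card_of_Times_same_infinite[of "UNIV :: real set"] infinite_UNIV_char_0 by simp
  finally show ?thesis .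
qed

section \<open>The Hahn--Banach theorem for normed subspaces\<close>

context normed_subspace
begin

lemma N_0 [simp]: "N 0 = 0"
  using N_eq_0[OF subspace_0[OF subspace_S]] by simp

text \<open>Partial functionals are represented by their graphs, real-linear subspaces \<open>G\<close> of
  \<open>S \<times> \<real>\<close> with \<open>r \<le> N x\<close> for all \<open>(x, r) \<in> G\<close>. Such a \<open>G\<close> is automatically single-valued, because the
  real multiples of a pair \<open>(0, r)\<close> are bounded above only for \<open>r = 0\<close>. Zorn's lemma gives a maximal \<open>G\<close>, and the
  usual one-dimensional extension shows that its domain is all of \<open>S\<close>.\<close>

lemma hahn_banach_real:
  assumes x0: "x0 \<in> S"
  obtains f :: "'z \<Rightarrow> real" where
    "\<And>x y. x \<in> S \<Longrightarrow> y \<in> S \<Longrightarrow> f (x + y) = f x + f y"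
    "\<And>t x. x \<in> S \<Longrightarrow> f (scale (of_real t) x) = t * f x"
    "\<And>x. x \<in> S \<Longrightarrow> \<bar>f x\<bar> \<le> N x" "f x0 = N x0"
proof -
  define lin where "lin G \<longleftrightarrow> G \<subseteq> S \<times> UNIV \<and>
    (\<forall>x r y s. (x, r) \<in> G \<longrightarrow> (y, s) \<in> G \<longrightarrow> (x + y, r + s) \<in> G) \<and>
    (\<forall>t x r. (x, r) \<in> G \<longrightarrow> (scale (of_real t) x, t * r) \<in> G) \<and>
    (\<forall>x r. (x, r) \<in> G \<longrightarrow> r \<le> N x)" for G :: "('z \<times> real) set"
  define \<G> where "\<G> = {G. lin G \<and> (x0, N x0) \<in> G}"
  have scale_S: "scale a x \<in> S" if "x \<in> S" for a x
    using subspace_scale[OF subspace_S that] .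
  have "range (\<lambda>t. (scale (of_real t) x0, t * N x0)) \<in> \<G>"
    unfolding \<G>_def lin_def mem_Collect_eq
  proof (intro conjI allI impI)
    show "(x0, N x0) \<in> range (\<lambda>t. (scale (of_real t) x0, t * N x0))"
      by (auto intro!: image_eqI[of _ _ 1])
  next
    fix x r assume "(x, r) \<in> range (\<lambda>t. (scale (of_real t) x0, t * N x0))"
    then show "r \<le> N x"
      using x0 by (auto simp: N_scale intro!: mult_right_mono N_nonneg)
  qed (use x0 scale_S in \<open>auto simp: image_iff scale_left_distrib[symmetric] of_real_add[symmetric] of_real_mult[symmetric]
        distrib_right[symmetric] simp del: of_real_add of_real_mult intro: exI\<close>)
  then have "\<G> \<noteq> {}" by blast
  have "\<exists>G\<in>\<G>. \<forall>H\<in>\<G>. G \<subseteq> H \<longrightarrow> H = G"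
  proof (rule subset_Zorn_nonempty[OF \<open>\<G> \<noteq> {}\<close>])
    fix C assume C: "C \<noteq> {}" "subset.chain \<G> C"
    have 1: "lin G" "(x0, N x0) \<in> G" if "G \<in> C" for G
      using that C(2) by (auto simp: subset.chain_def \<G>_def)
    have 2: "\<exists>G\<in>C. p \<in> G \<and> q \<in> G" if "p \<in> \<Union>C" "q \<in> \<Union>C" for p q
      using that C(2) unfolding subset.chain_def by blast
    have add: "(x + y, r + s) \<in> G" if "G \<in> C" "(x, r) \<in> G" "(y, s) \<in> G" for G x y r s
      using 1(1)[OF that(1)] that(2,3) unfolding lin_def by blast
    have sub: "x \<in> S" "r \<le> N x" "(scale (of_real t) x, t * r) \<in> G" if "G \<in> C" "(x, r) \<in> G" for G x r t
      using 1(1)[OF that(1)] that(2) unfolding lin_def by blast+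
    have "lin (\<Union>C)"
      unfolding lin_def
    proof (intro conjI allI impI)
      fix x r y s assume "(x, r) \<in> \<Union>C" "(y, s) \<in> \<Union>C"
      then obtain G where "G \<in> C" "(x, r) \<in> G" "(y, s) \<in> G" using 2 by blast
      then show "(x + y, r + s) \<in> \<Union>C" using add by blast
    qed (use sub in fast)+
    then show "\<Union>C \<in> \<G>" using C(1) 1(2) by (auto simp: \<G>_def)
  qed
  then obtain G where "G \<in> \<G>" and max: "\<And>H. H \<in> \<G> \<Longrightarrow> G \<subseteq> H \<Longrightarrow> H = G" by blast
  then have G0: "(x0, N x0) \<in> G"
    and GS: "\<And>x r. (x, r) \<in> G \<Longrightarrow> x \<in> S"
    and Gadd: "\<And>x r y s. (x, r) \<in> G \<Longrightarrow> (y, s) \<in> G \<Longrightarrow> (x + y, r + s) \<in> G"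
    and Gscale: "\<And>t x r. (x, r) \<in> G \<Longrightarrow> (scale (of_real t) x, t * r) \<in> G"
    and GN: "\<And>x r. (x, r) \<in> G \<Longrightarrow> r \<le> N x"
    unfolding \<G>_def lin_def by blast+
  have G00: "(0, 0) \<in> G" using Gscale[OF G0, of 0] by simp
  have unique: "r = s" if "(x, r) \<in> G" "(x, s) \<in> G" for x r s
  proof -
    have "t * (r - s) \<le> 0" for t
      using GN[OF Gscale[OF Gadd[OF that(1) Gscale[OF that(2), of "-1"]], of t]] by simp
    from this[of 1] this[of "-1"] show ?thesis by simp
  qed
  have total: "\<exists>c. (x, c) \<in> G" if x: "x \<in> S" for x
  proof -
    \<comment> \<open>Any value \<open>c\<close> for the functional at \<open>x\<close> that separates the left-hand sides from the right-hand sides is admissible.\<close>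
    have gap: "r - N (y - x) \<le> N (z + x) - s" if "(y, r) \<in> G" "(z, s) \<in> G" for y r z s
    proof -
      have "r + s \<le> N ((y - x) + (z + x))" using GN[OF Gadd[OF that]] by (simp add: algebra_simps)
      also have "\<dots> \<le> N (y - x) + N (z + x)"
        using GS that x subspace_S by (intro N_triangle subspace_diff subspace_add)
      finally show ?thesis by simp
    qed
    define D where "D = (\<lambda>(y, r). r - N (y - x)) ` G"
    have "D \<noteq> {}" using G00 by (auto simp: D_def)
    have "bdd_above D" unfolding bdd_above_def D_def using gap[OF _ G00] by fastforce
    define c where "c = Sup D"
    have lower: "r - N (y - x) \<le> c" if "(y, r) \<in> G" for y r
      unfolding c_def using that by (intro cSup_upper \<open>bdd_above D\<close>) (auto simp: D_def)
    have upper: "c \<le> N (z + x) - s" if "(z, s) \<in> G" for z s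
      unfolding c_def using that gap by (intro cSup_least \<open>D \<noteq> {}\<close>) (auto simp: D_def)
    have dom: "r + t * c \<le> N (y + scale (of_real t) x)" if yr: "(y, r) \<in> G" for y r t
    proof (cases "t = 0")
      case True then show ?thesis using GN[OF yr] by simp
    next
      case False
      \<comment> \<open>Rescaling by \<open>\<bar>t\<bar>\<close> reduces the bound to the cases \<open>t = 1\<close> and \<open>t = -1\<close>.\<close>
      define y' where "y' = scale (of_real (1 / \<bar>t\<bar>)) y"
      have y': "(y', (1 / \<bar>t\<bar>) * r) \<in> G" unfolding y'_def by (rule Gscale[OF yr])
      have y: "y = scale (of_real \<bar>t\<bar>) y'" unfolding y'_def using False
        by (simp add: of_real_mult[symmetric] del: of_real_mult of_real_divide)
      have "(1 / \<bar>t\<bar>) * r + sgn t * c \<le> N (y' + scale (of_real (sgn t)) x)"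
        using lower[OF y'] upper[OF y'] False by (cases "t > 0") auto
      then have "\<bar>t\<bar> * ((1 / \<bar>t\<bar>) * r + sgn t * c) \<le> \<bar>t\<bar> * N (y' + scale (of_real (sgn t)) x)"
        by (intro mult_left_mono) auto
      also have "\<bar>t\<bar> * ((1 / \<bar>t\<bar>) * r + sgn t * c) = r + t * c"
        using False by (simp add: distrib_left mult.assoc[symmetric] abs_mult_sgn)
      also have "\<bar>t\<bar> * N (y' + scale (of_real (sgn t)) x)
          = N (scale (of_real \<bar>t\<bar>) (y' + scale (of_real (sgn t)) x))"
        using GS[OF y'] x subspace_S by (simp add: N_scale subspace_add scale_S)
      also have "scale (of_real \<bar>t\<bar>) (y' + scale (of_real (sgn t)) x) = y + scale (of_real t) x"
        by (simp add: scale_right_distrib y of_real_mult[symmetric] abs_mult_sgn del: of_real_mult)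
      finally show ?thesis .
    qed
    define H where "H = {(y + scale (of_real t) x, r + t * c) | y r t. (y, r) \<in> G}"
    have HI: "(y + scale (of_real t) x, r + t * c) \<in> H" if "(y, r) \<in> G" for y r t
      using that by (auto simp: H_def)
    have "lin H"
      unfolding lin_def
    proof (intro conjI allI impI)
      show "H \<subseteq> S \<times> UNIV" using GS x by (auto simp: H_def intro!: subspace_add[OF subspace_S] scale_S)
      fix y r assume "(y, r) \<in> H"
      then obtain y1 r1 t where yr: "(y1, r1) \<in> G" "y = y1 + scale (of_real t) x" "r = r1 + t * c"
        by (auto simp: H_def)
      show "r \<le> N y" using dom[OF yr(1)] yr by simp
      show "(scale (of_real a) y, a * r) \<in> H" for a
        using HI[OF Gscale[OF yr(1), of a], of "a * t"] yr(2,3)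
        by (simp add: scale_right_distrib distrib_left mult.assoc)
      fix z s assume "(z, s) \<in> H"
      then obtain z1 s1 t' where zs: "(z1, s1) \<in> G" "z = z1 + scale (of_real t') x" "s = s1 + t' * c"
        by (auto simp: H_def)
      show "(y + z, r + s) \<in> H"
        using HI[OF Gadd[OF yr(1) zs(1)], of "t + t'"] yr(2,3) zs(2,3)
        by (simp add: scale_left_distrib algebra_simps)
    qed
    moreover have "G \<subseteq> H"
      using HI[of _ _ 0] by auto
    \<comment> \<open>The extension \<open>H\<close> always has \<open>x\<close> in its domain, so maximality of \<open>G\<close> puts \<open>x\<close> in the domain of \<open>G\<close>.\<close>
    ultimately have "H = G" using max[of H] G0 by (auto simp: \<G>_def)
    moreover have "(x, c) \<in> H" using HI[OF G00, of 1] by simp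
    ultimately show ?thesis by blast
  qed
  define f where "f x = (THE r. (x, r) \<in> G)" for x
  have f: "f x = r" if "(x, r) \<in> G" for x r
    unfolding f_def using that unique by blast
  have fG: "(x, f x) \<in> G" if "x \<in> S" for x
    using total[OF that] f by blast
  show thesis
  proof
    show "f (x + y) = f x + f y" if "x \<in> S" "y \<in> S" for x y
      by (intro f Gadd fG that)
    show sc: "f (scale (of_real t) x) = t * f x" if "x \<in> S" for t x
      by (intro f Gscale fG that)
    show "\<bar>f x\<bar> \<le> N x" if "x \<in> S" for x
      using GN[OF fG[OF that]] GN[OF Gscale[OF fG[OF that], of "-1"]] N_scale[OF that, of "-1"] by simp
    show "f x0 = N x0" by (rule f[OF G0])
  qed
qed

text \<open>Values outside \<open>S\<close> are ignored, in accordance with \<open>normed_subspace\<close>, where only \<open>S\<close> carries a norm.\<close>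

definition bounded_functional :: "('z \<Rightarrow> 'k) \<Rightarrow> bool" where
  "bounded_functional \<psi> \<longleftrightarrow>
     (\<forall>x\<in>S. \<forall>y\<in>S. \<psi> (x + y) = \<psi> x + \<psi> y) \<and> (\<forall>a. \<forall>x\<in>S. \<psi> (scale a x) = a * \<psi> x) \<and>
     (\<exists>C. \<forall>x\<in>S. norm (\<psi> x) \<le> C * N x)"

text \<open>A real-linear functional \<open>f\<close> is made linear over the complex scalars by \<open>x \<mapsto> f x - i f (i x)\<close>; its
  real part is still \<open>f\<close>, so it does not vanish at \<open>x0\<close>.\<close>

lemma exists_functional_eq_1:
  assumes x0: "x0 \<in> S" "x0 \<noteq> 0"
  obtains \<psi> where "bounded_functional \<psi>" "\<psi> x0 = 1"
proof -
  note normalized = that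
  have *: thesis if \<psi>: "bounded_functional \<psi>" and nz: "\<psi> x0 \<noteq> 0" for \<psi>
  proof (rule normalized)
    obtain C where C: "\<And>x. x \<in> S \<Longrightarrow> norm (\<psi> x) \<le> C * N x"
      using \<psi> unfolding bounded_functional_def by metis
    have "norm (\<psi> x / \<psi> x0) \<le> (C / norm (\<psi> x0)) * N x" if "x \<in> S" for x
      using C[OF that] nz by (simp add: norm_divide divide_right_mono)
    then have "\<exists>D. \<forall>x\<in>S. norm (\<psi> x / \<psi> x0) \<le> D * N x" by blast
    then show "bounded_functional (\<lambda>x. \<psi> x / \<psi> x0)"
      using \<psi> by (auto simp: bounded_functional_def add_divide_distrib)
  qed (use nz in simp)
  obtain f :: "'z \<Rightarrow> real" where
    add: "\<And>x y. x \<in> S \<Longrightarrow> y \<in> S \<Longrightarrow> f (x + y) = f x + f y"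
    and scl: "\<And>t x. x \<in> S \<Longrightarrow> f (scale (of_real t) x) = t * f x"
    and le: "\<And>x. x \<in> S \<Longrightarrow> \<bar>f x\<bar> \<le> N x" and fx0: "f x0 = N x0"
    using hahn_banach_real[OF x0(1)] by blast
  have nz: "f x0 \<noteq> 0" using fx0 N_eq_0[OF x0(1)] x0(2) by simp
  show thesis
  proof (cases rule: real_or_complex_cases[where 'k = 'k])
    case real
    have "bounded_functional (\<lambda>x. of_real (f x))"
      unfolding bounded_functional_def
    proof (intro conjI ballI allI)
      show "of_real (f (scale a x)) = a * of_real (f x)" if "x \<in> S" for a x
        using real[of a] scl[OF that] by auto
      show "\<exists>C. \<forall>x\<in>S. norm (of_real (f x) :: 'k) \<le> C * N x"
        using le by (intro exI[of _ 1]) simp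
    qed (simp add: add)
    then show ?thesis using nz by (intro *) auto
  next
    case (complex i)
    have S: "scale a x \<in> S" if "x \<in> S" for a x using subspace_scale[OF subspace_S that] .
    define \<psi> where "\<psi> x = of_real (f x) - i * of_real (f (scale i x))" for x
    have \<psi>_add: "\<psi> (x + y) = \<psi> x + \<psi> y" if "x \<in> S" "y \<in> S" for x y
      using that by (simp add: \<psi>_def add scale_right_distrib S algebra_simps)
    have \<psi>_real: "\<psi> (scale (of_real t) x) = of_real t * \<psi> x" if "x \<in> S" for t x
    proof -
      have "f (scale i (scale (of_real t) x)) = t * f (scale i x)"
        unfolding scale_left_commute[of i] by (rule scl[OF S[OF that]])
      then show ?thesis using scl[OF that] by (simp only: \<psi>_def of_real_mult right_diff_distrib mult.left_commute)
    qed
    have \<psi>_i: "\<psi> (scale i x) = i * \<psi> x" if "x \<in> S" for x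
      using complex(1) scl[OF that, of "-1"]
      by (simp add: \<psi>_def mult.assoc[symmetric] right_diff_distrib)
    have "bounded_functional \<psi>"
      unfolding bounded_functional_def
    proof (intro conjI ballI allI)
      show "\<psi> (scale a x) = a * \<psi> x" if "x \<in> S" for a x
      proof -
        obtain r s where a: "a = of_real r + i * of_real s" using complex(3) by blast
        have "\<psi> (scale a x) = \<psi> (scale (of_real r) x) + \<psi> (scale i (scale (of_real s) x))"
          using that by (simp add: a scale_left_distrib \<psi>_add S)
        then show ?thesis
          using \<psi>_i[OF S[OF that], of "of_real s"] that by (simp add: \<psi>_real a distrib_right mult.assoc)
      qed
      show "\<exists>C. \<forall>x\<in>S. norm (\<psi> x) \<le> C * N x"
      proof (intro exI[of _ 2] ballI)
        fix x assume x: "x \<in> S"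
        have "norm (\<psi> x) \<le> norm (of_real (f x) :: 'k) + norm (i * of_real (f (scale i x)))"
          unfolding \<psi>_def by (rule norm_triangle_ineq4)
        also have "\<dots> \<le> N x + N (scale i x)"
          using le[OF x] le[OF S[OF x]] complex(2) by (simp add: norm_mult add_mono)
        finally show "norm (\<psi> x) \<le> 2 * N x" using x complex(2) by (simp add: N_scale)
      qed
    qed (simp add: \<psi>_add)
    moreover have "\<psi> x0 \<noteq> 0"
    proof
      assume "\<psi> x0 = 0"
      then have "of_real (f x0) + i * of_real (- f (scale i x0)) = 0" by (simp add: \<psi>_def)
      then show False using complex(4) nz by blast
    qed
    ultimately show ?thesis by (rule *)
  qed
qed

lemma bounded_functional_bound:
  assumes "bounded_functional \<psi>"
  obtains C where "0 \<le> C" "\<And>x. x \<in> S \<Longrightarrow> norm (\<psi> x) \<le> C * N x"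
proof -
  obtain C where C: "\<And>x. x \<in> S \<Longrightarrow> norm (\<psi> x) \<le> C * N x"
    using assms unfolding bounded_functional_def by metis
  have "norm (\<psi> x) \<le> \<bar>C\<bar> * N x" if "x \<in> S" for x
    using C[OF that] mult_right_mono[OF abs_ge_self[of C] N_nonneg[OF that]] by simp
  then show thesis using that[of "\<bar>C\<bar>"] by simp
qed

lemma bounded_functional_diff:
  assumes "bounded_functional \<psi>" "x \<in> S" "y \<in> S"
  shows "\<psi> (x - y) = \<psi> x - \<psi> y"
proof -
  have "\<psi> (x - y) + \<psi> y = \<psi> (x - y + y)"
    using assms subspace_diff[OF subspace_S assms(2,3)] unfolding bounded_functional_def by metis
  then show ?thesis by (simp add: eq_diff_eq)
qed

end

section \<open>Hamel dimension and cardinality\<close>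

context vector_space
begin

text \<open>The Hamel dimension is the cardinality of an arbitrarily chosen basis; this lemma makes it usable, since
  any two bases of \<open>W\<close> are in bijection and \<open>B\<close> extends to one of them.\<close>

lemma card_of_independent_le_hamel_dim:
  assumes B: "independent B" "B \<subseteq> W" and W: "subspace W"
  shows "|B| \<le>o hamel_dim scale W"
proof -
  obtain C where C: "B \<subseteq> C" "C \<subseteq> W" "independent C" "W \<subseteq> span C"
    using maximal_independent_subset_extend[OF B(2,1)] by metis
  obtain D where D: "D \<subseteq> W" "independent D" "span D = W" "hamel_dim scale W = |D|"
    using hamel_dim_basis[OF W] .
  have "span C = span D"
    using C(2,4) W D(3) span_minimal by blast
  then obtain f where "bij_betw f C D"
    using bij_if_span_eq_span_bases[OF C(3) D(2)] by blast
  then have "|C| =o hamel_dim scale W"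
    unfolding D(4) by (rule card_of_ordIsoI)
  moreover have "|B| \<le>o |C|" by (rule card_of_mono1[OF C(1)])
  ultimately show ?thesis by (rule ordLeq_ordIso_trans[rotated])
qed

lemma hamel_dim_le_card_of:
  assumes "subspace W" shows "hamel_dim scale W \<le>o |W|"
  using hamel_dim_basis[OF assms] card_of_mono1 by metis

lemma hamel_dim_mono:
  assumes "subspace W" "subspace W'" "W \<subseteq> W'"
  shows "hamel_dim scale W \<le>o hamel_dim scale W'"
proof -
  obtain D where "D \<subseteq> W" "independent D" "hamel_dim scale W = |D|"
    using hamel_dim_basis[OF assms(1)] by metis
  then show ?thesis using card_of_independent_le_hamel_dim[of D W'] assms by auto
qed

text \<open>The span is the union of the countably many sets \<open>L n\<close> of combinations of \<open>n\<close> vectors, and each step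
  from \<open>L n\<close> to \<open>L (Suc n)\<close> multiplies the cardinality by at most \<open>r\<close>.\<close>

lemma card_of_span_le:
  assumes r: "Card_order r" "\<not> finite (Field r)"
    and K: "|UNIV :: 'a set| \<le>o r" and B: "|B| \<le>o r"
  shows "|span B| \<le>o r"
proof -
  define L where "L = rec_nat {0} (\<lambda>n M. (\<lambda>(a, b, x). scale a b + x) ` (UNIV \<times> B \<times> M))"
  have L0: "L 0 = {0}" and LSuc: "L (Suc n) = (\<lambda>(a, b, x). scale a b + x) ` (UNIV \<times> B \<times> L n)" for n
    by (simp_all add: L_def)
  have L: "|L n| \<le>o r" for n
  proof (induction n)
    case 0
    have "Field r \<noteq> {}" using r(2) by auto
    then show ?case unfolding L0 using r(1) by (intro Card_order_singl_ordLeq)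
  next
    case (Suc n)
    have "|(UNIV :: 'a set) \<times> B \<times> L n| \<le>o r"
      by (intro card_of_Times_ordLeq_infinite_Field r K B Suc)
    then show ?case unfolding LSuc by (rule ordLeq_transitive[OF card_of_image])
  qed
  have "span B \<subseteq> (\<Union>n\<in>UNIV. L n)"
  proof
    fix x assume "x \<in> span B"
    then show "x \<in> (\<Union>n\<in>UNIV. L n)"
    proof (induction rule: span_induct_alt)
      case base
      show ?case using L0 by blast
    next
      case (step c b y)
      then obtain n where "y \<in> L n" by blast
      then have "scale c b + y \<in> L (Suc n)" unfolding LSuc using step by force
      then show ?case by blast
    qed
  qed
  then have "|span B| \<le>o |\<Union>n\<in>UNIV. L n|" by (rule card_of_mono1)
  moreover have "|UNIV :: nat set| \<le>o r"
    using infinite_iff_card_of_nat[of "Field r"] r card_of_Field_ordIso[OF r(1)]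
    by (metis ordLeq_ordIso_trans)
  then have "|\<Union>n\<in>UNIV. L n| \<le>o r"
    using L by (intro card_of_UNION_ordLeq_infinite_Field r) auto
  ultimately show ?thesis by (rule ordLeq_transitive)
qed

end

lemma (in vector_space_pair) hamel_dim_le_of_inj_on:
  assumes f: "Vector_Spaces.linear s1 s2 f" "inj_on f W" "f ` W \<subseteq> W'"
    and W: "vs1.subspace W" and W': "vs2.subspace W'"
  shows "hamel_dim s1 W \<le>o hamel_dim s2 W'"
proof -
  obtain B where B: "B \<subseteq> W" "vs1.independent B" "vs1.span B = W" "hamel_dim s1 W = |B|"
    using vs1.hamel_dim_basis[OF W] .
  have "vs2.independent (f ` B)"
    using linear_independent_injective_image[OF f(1) B(2)] f(2) B(3) by simp
  then have "|f ` B| \<le>o hamel_dim s2 W'"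
    by (rule vs2.card_of_independent_le_hamel_dim[OF _ _ W']) (use B(1) f(3) in blast)
  moreover have "|B| =o |f ` B|"
    using B(1) f(2) by (intro card_of_ordIsoI[of f]) (auto simp: bij_betw_def intro: inj_on_subset)
  ultimately show ?thesis unfolding B(4) by (rule ordIso_ordLeq_trans[rotated])
qed

lemma (in vector_space) subspace_of_dimension_one:
  assumes "subspace W" "hamel_dim scale W =o BNF_Cardinal_Arithmetic.cone"
  obtains w where "w \<in> W" "w \<noteq> 0" "W = span {w}"
proof -
  obtain B where B: "B \<subseteq> W" "independent B" "span B = W" "hamel_dim scale W = |B|"
    using hamel_dim_basis[OF assms(1)] .
  have "|B| =o |{()}|" using assms(2) by (simp add: B(4) BNF_Cardinal_Arithmetic.cone_def)
  then obtain f where "bij_betw f B {()}" using card_of_ordIso by blast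
  then have "card B = 1" by (simp add: bij_betw_same_card)
  then obtain w where w: "B = {w}" using card_1_singletonE by blast
  show thesis
  proof (rule that)
    show "w \<in> W" "W = span {w}" using B(1,3) unfolding w by auto
    show "w \<noteq> 0" using B(2) dependent_zero[of B] unfolding w by blast
  qed
qed

lemma card_max_cases:
  assumes "Card_order r" "Card_order s"
  obtains "r \<le>o s" "card_max r s =o s" | "s \<le>o r" "card_max r s =o r"
proof (cases "r \<le>o s")
  case True
  then show ?thesis using that(1) card_max_right[OF assms(2)] by blast
next
  case False
  then have "s \<le>o r"
    using assms by (metis card_order_on_well_order_on ordLeq_total)
  then show ?thesis using that(2) card_max_left[OF assms] by blast
qed

lemma card_max_least:
  assumes "Card_order r" "Card_order s" "r \<le>o t" "s \<le>o t"
  shows "card_max r s \<le>o t"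
  using assms by (cases rule: card_max_cases[OF assms(1,2)]) (blast intro: ordIso_ordLeq_trans)+

lemma card_max_upper:
  assumes "Card_order r" "Card_order s"
  shows "r \<le>o card_max r s" "s \<le>o card_max r s"
proof -
  have "r \<le>o r" "s \<le>o s" using assms by (simp_all add: card_order_on_well_order_on ordLeq_reflexive)
  then have "r \<le>o card_max r s \<and> s \<le>o card_max r s"
    by (cases rule: card_max_cases[OF assms]) (blast intro: ordLeq_ordIso_trans ordIso_symmetric)+
  then show "r \<le>o card_max r s" "s \<le>o card_max r s" by auto
qed

lemma Card_order_hamel_dim: "Card_order (hamel_dim scl W)"
  unfolding hamel_dim_def by (rule card_of_Card_order)

lemma Card_order_card_max: "Card_order (card_max r s)"
  by (cases "r \<le>o s") (simp_all only: card_max_def if_True if_False card_of_Card_order)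

lemma infinite_Field_if_continuum_le:
  assumes "Card_order r" "|UNIV :: real set| \<le>o r"
  shows "infinite (Field r)"
proof -
  have "|UNIV :: real set| \<le>o |Field r|"
    using assms card_of_Field_ordIso ordLeq_ordIso_trans ordIso_symmetric by blast
  then show ?thesis
    using card_of_ordLeq_infinite infinite_UNIV_char_0 by blast
qed

section \<open>Countable powers of a Banach space\<close>

text \<open>A maximal \<open>d\<close>-separated subset of the ball of radius \<open>R\<close> is \<open>d\<close>-dense in that ball. Rounding to it is
  accurate on the ball, while distinct rounded values stay apart, so that a rounded value can later be
  recovered from approximate knowledge.\<close>

lemma finite_precision_rounding:
  fixes d R :: real
  assumes "0 < d" "0 \<le> R"
  obtains p :: "'x::real_normed_vector \<Rightarrow> 'x" where
    "\<And>x. norm (p x) \<le> R" "\<And>x. norm x \<le> R \<Longrightarrow> norm (p x - x) < d"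
    "\<And>x y. p x \<noteq> p y \<Longrightarrow> d \<le> norm (p x - p y)"
proof -
  define sep where "sep D \<longleftrightarrow> D \<subseteq> cball 0 R \<and> (\<forall>x\<in>D. \<forall>y\<in>D. x \<noteq> y \<longrightarrow> d \<le> norm (x - y))"
    for D :: "'x set"
  have "\<exists>D\<in>Collect sep. \<forall>H\<in>Collect sep. D \<subseteq> H \<longrightarrow> H = D"
  proof (rule subset_Zorn_nonempty)
    show "Collect sep \<noteq> {}" by (auto simp: sep_def intro: exI[of _ "{}"])
    fix C assume C: "C \<noteq> {}" "subset.chain (Collect sep) C"
    then have 1: "sep D" if "D \<in> C" for D using that by (auto simp: subset.chain_def)
    have 2: "\<exists>D\<in>C. x \<in> D \<and> y \<in> D" if "x \<in> \<Union>C" "y \<in> \<Union>C" for x y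
      using that C(2) unfolding subset.chain_def by blast
    have "sep (\<Union>C)"
      unfolding sep_def
    proof (intro conjI ballI impI)
      show "\<Union>C \<subseteq> cball 0 R" using 1 unfolding sep_def by blast
      fix x y assume "x \<in> \<Union>C" "y \<in> \<Union>C" "x \<noteq> y"
      then show "d \<le> norm (x - y)" using 1 2[of x y] unfolding sep_def by blast
    qed
    then show "\<Union>C \<in> Collect sep" by simp
  qed
  then obtain D where D: "sep D" and max: "\<And>H. sep H \<Longrightarrow> D \<subseteq> H \<Longrightarrow> H = D" by auto
  have near: "\<exists>y\<in>D. norm (y - x) < d" if x: "norm x \<le> R" for x
  proof (rule ccontr)
    assume "\<not> ?thesis"
    then have far: "d \<le> norm (y - x)" if "y \<in> D" for y using that by force
    have "sep (insert x D)"
      using D x far by (auto simp: sep_def norm_minus_commute)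
    then have "x \<in> D" using max by blast
    then show False using far[of x] \<open>0 < d\<close> by simp
  qed
  define p where "p x = (if norm x \<le> R then SOME y. y \<in> D \<and> norm (y - x) < d
      else SOME y. y \<in> D)" for x
  have "D \<noteq> {}" using near[of 0] \<open>0 \<le> R\<close> by auto
  have p1: "p x \<in> D \<and> norm (p x - x) < d" if "norm x \<le> R" for x
    unfolding p_def using that someI_ex[of "\<lambda>y. y \<in> D \<and> norm (y - x) < d"] near[OF that] by auto
  have p2: "p x \<in> D" for x
    using p1[of x] \<open>D \<noteq> {}\<close> by (cases "norm x \<le> R") (auto simp: p_def some_in_eq)
  show thesis
  proof (rule that)
    show "norm (p x) \<le> R" for x using p2[of x] D by (auto simp: sep_def)
    show "norm (p x - x) < d" if "norm x \<le> R" for x using p1[OF that] by simp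
    show "d \<le> norm (p x - p y)" if "p x \<noteq> p y" for x y
      using p2 that D by (auto simp: sep_def)
  qed
qed

text \<open>At the first index \<open>m\<close> at which the sequences differ, the terms are at least \<open>a m / 2^m\<close> apart. The weights
  decrease so fast that all later terms together cannot compensate: with \<open>a m = 2^-(m+2)^2\<close> the \<open>k\<close>-th term of
  the tail is at most \<open>2^-(k+2)\<close> times that gap.\<close>

lemma inj_fast_series:
  fixes z w :: "nat \<Rightarrow> 'x::banach"
  defines "a \<equiv> \<lambda>m. (1 / 2 :: real) ^ (m + 2)\<^sup>2"
  assumes bound: "\<And>m. norm (z m) \<le> 2 ^ m" "\<And>m. norm (w m) \<le> 2 ^ m"
    and sep: "\<And>m. z m \<noteq> w m \<Longrightarrow> (1 / 2) ^ m \<le> norm (z m - w m)"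
    and eq: "(\<Sum>m. a m *\<^sub>R z m) = (\<Sum>m. a m *\<^sub>R w m)"
  shows "z = w"
proof (rule ccontr)
  have a_pos: "0 < a m" for m by (simp add: a_def)
  have tail: "a (m + Suc k) * 2 ^ (m + Suc k) * 2 \<le> a m * (1 / 2) ^ m * (1 / 2) ^ Suc (Suc k)" for m k
  proof -
    have "(m + 2)\<^sup>2 + m + Suc (Suc k) + (m + Suc k) + 1 \<le> (m + Suc k + 2)\<^sup>2"
      by (simp add: power2_eq_square algebra_simps)
    then have "(2::real) ^ ((m + 2)\<^sup>2 + m + Suc (Suc k) + (m + Suc k) + 1) \<le> 2 ^ ((m + Suc k + 2)\<^sup>2)"
      by (rule power_increasing) simp
    then show ?thesis
      by (simp add: a_def power_divide power_add field_simps)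
  qed
  have smbl: "summable (\<lambda>m. a m *\<^sub>R y m)" if "\<And>m. norm (y m) \<le> 2 ^ m" for y :: "nat \<Rightarrow> 'x"
  proof (rule summable_comparison_test')
    show "summable (\<lambda>m. (1 / 2 :: real) ^ m)" by simp
    fix m :: nat
    have "norm (a m *\<^sub>R y m) \<le> a m * 2 ^ m" using that[of m] a_pos[of m] by simp
    also have "(2::real) ^ (m + m) \<le> 2 ^ ((m + 2)\<^sup>2)"
      by (rule power_increasing) (auto simp: power2_eq_square)
    then have "a m * 2 ^ m \<le> (1 / 2) ^ m"
      by (simp add: a_def power_divide power_add field_simps)
    finally show "norm (a m *\<^sub>R y m) \<le> (1 / 2) ^ m" .
  qed
  assume "z \<noteq> w"
  then have ex: "\<exists>m. z m \<noteq> w m" by auto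
  define m where "m = (LEAST m. z m \<noteq> w m)"
  have m: "z m \<noteq> w m" unfolding m_def using ex by (rule LeastI_ex)
  have below: "z k = w k" if "k < m" for k using not_less_Least[of k "\<lambda>m. z m \<noteq> w m"] that by (auto simp: m_def)
  define y where "y k = a k *\<^sub>R (z k - w k)" for k
  have "summable y" unfolding y_def scaleR_diff_right by (intro summable_diff smbl bound)
  have "suminf y = 0" unfolding y_def scaleR_diff_right
    using eq by (subst suminf_diff[symmetric]) (auto intro: smbl bound)
  then have "0 = (\<Sum>k. y (k + Suc m)) + sum y {..<Suc m}"
    using suminf_split_initial_segment[OF \<open>summable y\<close>, of "Suc m"] by simp
  also have "sum y {..<Suc m} = y m" by (simp add: y_def below)
  finally have "y m = - (\<Sum>k. y (k + Suc m))"
    by (simp add: eq_neg_iff_add_eq_0 add.commute)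
  then have "norm (y m) = norm (\<Sum>k. y (Suc m + k))"
    by (simp add: add.commute)
  also have "\<dots> \<le> (\<Sum>k. a m * (1 / 2) ^ m * (1 / 2) ^ Suc (Suc k))"
  proof (rule norm_suminf_le)
    fix k
    let ?j = "m + Suc k"
    have "norm (z ?j - w ?j) \<le> 2 ^ ?j * 2"
      using norm_triangle_ineq4[of "z ?j" "w ?j"] bound[of ?j] by simp
    then have "norm (y ?j) \<le> a ?j * (2 ^ ?j * 2)" using a_pos[of ?j] by (simp add: y_def)
    also have "\<dots> \<le> a m * (1 / 2) ^ m * (1 / 2) ^ Suc (Suc k)"
      using tail[of m k] by (simp only: mult.assoc)
    finally show "norm (y (Suc m + k)) \<le> a m * (1 / 2) ^ m * (1 / 2) ^ Suc (Suc k)" by simp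
    show "summable (\<lambda>k. a m * (1 / 2) ^ m * (1 / 2 :: real) ^ Suc (Suc k))"
      by (intro summable_mult) (simp add: summable_mult)
  qed
  also have "\<dots> = a m * (1 / 2) ^ m * (1 / 2)"
  proof -
    have "(\<lambda>k. a m * (1 / 2) ^ m * (1 / 4) * (1 / 2 :: real) ^ k) sums (a m * (1 / 2) ^ m * (1 / 4) * 2)"
      using geometric_sums[of "1 / 2 :: real"] by (intro sums_mult) simp
    then show ?thesis by (simp add: sums_iff mult_ac)
  qed
  also have "\<dots> < a m * (1 / 2) ^ m" using a_pos[of m] by simp
  also have "\<dots> \<le> norm (y m)" using sep[OF m] a_pos[of m] by (simp add: y_def)
  finally show False by simp
qed

text \<open>A point \<open>x\<close> is the limit of its roundings \<open>p n x\<close> to precision \<open>2^-n\<close> in the ball of radius \<open>2^n\<close>. So a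
  sequence \<open>s\<close> is determined by the double sequence \<open>p n (s k)\<close>, which is enumerated by pairs \<open>(k, n)\<close> and
  encoded in a single point by \<open>inj_fast_series\<close>.\<close>

lemma inj_sequences_into_banach: "\<exists>g :: (nat \<Rightarrow> 'x::banach) \<Rightarrow> 'x. inj g"
proof -
  have "\<exists>p :: nat \<Rightarrow> 'x \<Rightarrow> 'x. \<forall>n. (\<forall>x. norm (p n x) \<le> 2 ^ n) \<and>
      (\<forall>x. norm x \<le> 2 ^ n \<longrightarrow> norm (p n x - x) < (1 / 2) ^ n) \<and>
      (\<forall>x y. p n x \<noteq> p n y \<longrightarrow> (1 / 2) ^ n \<le> norm (p n x - p n y))"
  proof (rule choice, rule allI)
    fix n :: nat
    show "\<exists>p :: 'x \<Rightarrow> 'x. (\<forall>x. norm (p x) \<le> 2 ^ n) \<and>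
      (\<forall>x. norm x \<le> 2 ^ n \<longrightarrow> norm (p x - x) < (1 / 2) ^ n) \<and>
      (\<forall>x y. p x \<noteq> p y \<longrightarrow> (1 / 2) ^ n \<le> norm (p x - p y))"
      by (rule finite_precision_rounding[of "(1 / 2) ^ n" "2 ^ n"]) auto
  qed
  then obtain p :: "nat \<Rightarrow> 'x \<Rightarrow> 'x" where
    p_bound: "\<And>n x. norm (p n x) \<le> 2 ^ n"
    and p_near: "\<And>n x. norm x \<le> 2 ^ n \<Longrightarrow> norm (p n x - x) < (1 / 2) ^ n"
    and p_sep: "\<And>n x y. p n x \<noteq> p n y \<Longrightarrow> (1 / 2) ^ n \<le> norm (p n x - p n y)"
    by blast
  have p_lim: "(\<lambda>n. p n x) \<longlonglongrightarrow> x" for x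
  proof (rule Lim_transform_eventually[OF _ always_eventually])
    have "(\<lambda>n. p n x - x) \<longlonglongrightarrow> 0"
    proof (rule Lim_null_comparison)
      obtain n0 where n0: "norm x < 2 ^ n0" using real_arch_pow[of 2 "norm x"] by auto
      show "\<forall>\<^sub>F n in sequentially. norm (p n x - x) \<le> (1 / 2) ^ n"
      proof (rule eventually_sequentiallyI[of n0])
        fix n assume "n0 \<le> n"
        then have "norm x \<le> 2 ^ n" using n0 power_increasing[of n0 n "2::real"] by (intro order_trans[OF less_imp_le[OF n0]]) simp
        then show "norm (p n x - x) \<le> (1 / 2) ^ n" using p_near by (simp add: less_imp_le)
      qed
      show "(\<lambda>n. (1 / 2 :: real) ^ n) \<longlonglongrightarrow> 0" by (intro LIMSEQ_power_zero) simp
    qed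
    from tendsto_add[OF this tendsto_const[of x]] show "(\<lambda>n. (p n x - x) + x) \<longlonglongrightarrow> x" by simp
  qed simp
  define t where "t s m = p (snd (prod_decode m)) (s (fst (prod_decode m)))" for s m
  \<comment> \<open>Hence the precision and the bound of the rounding in position \<open>m\<close> are controlled by \<open>m\<close> itself.\<close>
  have le: "snd (prod_decode m) \<le> m" for m
    by (metis le_prod_encode_2 prod.collapse prod_decode_inverse)
  have "inj (\<lambda>s. \<Sum>m. (1 / 2 :: real) ^ (m + 2)\<^sup>2 *\<^sub>R t s m)"
  proof (rule injI)
    fix s s' :: "nat \<Rightarrow> 'x"
    assume eq: "(\<Sum>m. (1 / 2 :: real) ^ (m + 2)\<^sup>2 *\<^sub>R t s m) = (\<Sum>m. (1 / 2 :: real) ^ (m + 2)\<^sup>2 *\<^sub>R t s' m)"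
    have bound: "norm (t s m) \<le> 2 ^ m" for s m
      unfolding t_def
      by (rule order_trans[OF p_bound power_increasing[OF le]]) simp
    have "t s = t s'"
    proof (rule inj_fast_series[OF bound bound _ eq])
      fix m assume "t s m \<noteq> t s' m"
      then have "(1 / 2) ^ snd (prod_decode m) \<le> norm (t s m - t s' m)"
        unfolding t_def by (rule p_sep)
      moreover have "(1 / 2 :: real) ^ m \<le> (1 / 2) ^ snd (prod_decode m)"
        by (rule power_decreasing[OF le]) auto
      ultimately show "(1 / 2) ^ m \<le> norm (t s m - t s' m)" by (rule order_trans[rotated])
    qed
    have "p n (s k) = p n (s' k)" for n k
      using fun_cong[OF \<open>t s = t s'\<close>, of "prod_encode (k, n)"] by (simp add: t_def)
    then have "s k = s' k" for k
      using LIMSEQ_unique[OF p_lim[of "s k"]] p_lim[of "s' k"] by simp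
    then show "s = s'" by auto
  qed
  then show ?thesis by blast
qed

lemma card_of_sequence_space_le:
  fixes E :: "(nat \<Rightarrow> 'x::banach) set"
  shows "|E| \<le>o |UNIV :: 'x set|"
proof -
  obtain g :: "(nat \<Rightarrow> 'x) \<Rightarrow> 'x" where "inj g" using inj_sequences_into_banach by blast
  then have "inj_on g E \<and> g ` E \<subseteq> UNIV" by (auto intro: inj_on_subset)
  then show ?thesis using card_of_ordLeq by blast
qed

lemma card_of_banach_space_le:
  fixes scaleX :: "'k::real_or_complex \<Rightarrow> 'x::banach \<Rightarrow> 'x"
  assumes "normed_space_over scaleX"
  shows "|UNIV :: 'x set| \<le>o card_max |UNIV :: real set| (hamel_dim scaleX UNIV)"
    (is "_ \<le>o ?\<beta>")
proof -
  interpret X: normed_space_over scaleX by fact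
  obtain B where B: "X.span B = UNIV" "hamel_dim scaleX UNIV = |B|"
    using X.hamel_dim_basis[OF X.subspace_UNIV] by metis
  have real: "|UNIV :: real set| \<le>o ?\<beta>" and B_le: "|B| \<le>o ?\<beta>"
    using card_max_upper[OF card_of_Card_order card_of_Card_order] unfolding B(2) by blast+
  note Card = Card_order_card_max
  have "infinite (Field ?\<beta>)" by (rule infinite_Field_if_continuum_le[OF Card real])
  then have "|X.span B| \<le>o ?\<beta>"
    using ordLeq_transitive[OF card_of_scalars real] B_le by (intro X.card_of_span_le Card)
  then show ?thesis by (simp add: B(1))
qed

section \<open>Infinite-dimensional Banach spaces have Hamel dimension at least the continuum\<close>

text \<open>This is the invertibility of the Vandermonde matrix: the hypothesis extends from powers to all
  polynomials, in particular to one that vanishes at all points \<open>g s\<close> except \<open>g t\<close>.\<close>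

lemma eq_0_if_power_sums_eq_0:
  fixes c g :: "'b \<Rightarrow> 'a::field"
  assumes F: "finite F" and inj: "inj_on g F" and 0: "\<And>n. (\<Sum>t\<in>F. c t * g t ^ n) = 0"
    and t: "t \<in> F"
  shows "c t = 0"
proof -
  have poly: "(\<Sum>s\<in>F. c s * poly p (g s)) = 0" for p
  proof -
    have "(\<Sum>s\<in>F. c s * poly p (g s)) = (\<Sum>s\<in>F. \<Sum>i\<le>degree p. coeff p i * (c s * g s ^ i))"
      by (simp add: poly_altdef sum_distrib_left mult_ac)
    also have "\<dots> = (\<Sum>i\<le>degree p. coeff p i * (\<Sum>s\<in>F. c s * g s ^ i))"
      by (subst sum.swap) (simp add: sum_distrib_left)
    finally show ?thesis by (simp add: 0)
  qed
  define p where "p = (\<Prod>s\<in>F - {t}. [:- g s, 1:])"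
  have "poly p (g s) = 0" if "s \<in> F" "s \<noteq> t" for s
    using that F by (auto simp: p_def poly_prod)
  then have "c t * poly p (g t) = (\<Sum>s\<in>F. c s * poly p (g s))"
    using F t by (subst sum.remove[of F t]) (auto intro!: sum.neutral)
  moreover have "poly p (g t) \<noteq> 0"
    using F t inj by (auto simp: p_def poly_prod inj_on_def)
  ultimately show ?thesis using poly by auto
qed

context normed_subspace
begin

lemma N_sum_le:
  assumes "\<And>k. k \<in> A \<Longrightarrow> z k \<in> S" shows "N (\<Sum>k\<in>A. z k) \<le> (\<Sum>k\<in>A. N (z k))"
  using assms
proof (induction A rule: infinite_finite_induct)
  case (insert a A)
  then have "N (\<Sum>k\<in>insert a A. z k) \<le> N (z a) + N (\<Sum>k\<in>A. z k)"
    by (auto intro!: N_triangle subspace_sum[OF subspace_S])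
  also have "N (\<Sum>k\<in>A. z k) \<le> (\<Sum>k\<in>A. N (z k))" using insert by simp
  finally show ?case using insert by simp
qed simp_all

text \<open>The norm and its completeness live on a subspace \<open>S\<close> of the ambient type, which need not carry a topology of
  its own; hence convergence is expressed through the real sequence of values of \<open>N\<close>.\<close>

lemma abs_convergent_series:
  assumes complete: "Metric_space.mcomplete S (norm_dist S N)"
    and z: "\<And>n. z n \<in> S" and summable: "summable (\<lambda>n. N (z n))"
  obtains y where "y \<in> S" "(\<lambda>n. N (y - (\<Sum>k<n. z k))) \<longlonglongrightarrow> 0"
proof -
  interpret M: Metric_space S "norm_dist S N" by (rule Metric_space_norm_dist)
  define s where "s n = (\<Sum>k<n. z k)" for n
  have sS: "s n \<in> S" for n unfolding s_def by (intro subspace_sum subspace_S z)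
  have le: "norm_dist S N (s n) (s m) \<le> (\<Sum>k=m..<n. N (z k))" if "m \<le> n" for m n
  proof -
    have "s n - s m = (\<Sum>k=m..<n. z k)"
      unfolding s_def lessThan_atLeast0 using that by (simp add: sum_diff_nat_ivl)
    then show ?thesis using sS z N_sum_le[of "{m..<n}" z] by (simp add: norm_dist_def)
  qed
  have "M.MCauchy s"
    unfolding M.MCauchy_def
  proof (intro conjI allI impI)
    show "range s \<subseteq> S" using sS by auto
    fix e :: real assume "0 < e"
    then obtain n0 where n0: "\<And>m n. n0 \<le> m \<Longrightarrow> norm (\<Sum>k=m..<n. N (z k)) < e"
      using summable unfolding summable_Cauchy by blast
    have *: "norm_dist S N (s n) (s m) < e" if "n0 \<le> m" "m \<le> n" for m n
      using le[OF that(2)] n0[OF that(1), of n] by simp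
    have "norm_dist S N (s m) (s n) < e" if "n0 \<le> m" "n0 \<le> n" for m n
      using *[of m n] *[of n m] that M.commute[of "s m" "s n"] by (cases "m \<le> n") auto
    then show "\<exists>n0. \<forall>n n'. n0 \<le> n \<longrightarrow> n0 \<le> n' \<longrightarrow> norm_dist S N (s n) (s n') < e" by blast
  qed
  then obtain y where y: "limitin M.mtopology s y sequentially"
    using complete unfolding M.mcomplete_def by blast
  then have yS: "y \<in> S" and lim: "\<And>e. 0 < e \<Longrightarrow> \<forall>\<^sub>F n in sequentially. norm_dist S N (s n) y < e"
    unfolding M.limitin_metric by (auto elim: eventually_mono)
  have "(\<lambda>n. N (y - s n)) \<longlonglongrightarrow> 0"
  proof (rule tendstoI)
    fix e :: real assume "0 < e"
    from lim[OF this] show "\<forall>\<^sub>F n in sequentially. dist (N (y - s n)) 0 < e"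
    proof (rule eventually_mono)
      fix n assume "norm_dist S N (s n) y < e"
      then show "dist (N (y - s n)) 0 < e"
        using M.commute[of "s n" y] yS sS N_nonneg[of "y - s n"] subspace_diff[OF subspace_S yS sS]
        by (simp add: norm_dist_def)
    qed
  qed
  then show thesis using that yS by (simp add: s_def)
qed

lemma bounded_functional_sum:
  assumes \<psi>: "bounded_functional \<psi>" and z: "\<And>k. k \<in> A \<Longrightarrow> z k \<in> S"
  shows "\<psi> (\<Sum>k\<in>A. scale (c k) (z k)) = (\<Sum>k\<in>A. c k * \<psi> (z k))"
proof -
  have 0: "\<psi> 0 = 0" using \<psi> subspace_0[OF subspace_S] unfolding bounded_functional_def
    by (metis mult_zero_left scale_zero_left)
  show ?thesis
    using z
  proof (induction A rule: infinite_finite_induct)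
    case (insert a A)
    then have "scale (c a) (z a) \<in> S" "(\<Sum>k\<in>A. scale (c k) (z k)) \<in> S"
      using subspace_S by (auto intro!: subspace_scale subspace_sum)
    then show ?case using insert \<psi> by (simp add: bounded_functional_def)
  qed (simp_all add: 0)
qed

lemma bounded_functional_tendsto:
  assumes \<psi>: "bounded_functional \<psi>" and S: "y \<in> S" "\<And>n. s n \<in> S"
    and lim: "(\<lambda>n. N (y - s n)) \<longlonglongrightarrow> 0"
  shows "(\<lambda>n. \<psi> (s n)) \<longlonglongrightarrow> \<psi> y"
proof -
  obtain C where C: "\<And>x. x \<in> S \<Longrightarrow> norm (\<psi> x) \<le> C * N x"
    using bounded_functional_bound[OF \<psi>] by blast
  have "(\<lambda>n. \<psi> y - \<psi> (s n)) \<longlonglongrightarrow> 0"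
  proof (rule Lim_null_comparison)
    show "\<forall>\<^sub>F n in sequentially. norm (\<psi> y - \<psi> (s n)) \<le> C * N (y - s n)"
      using C[OF subspace_diff[OF subspace_S S]] bounded_functional_diff[OF \<psi> S] by simp
    show "(\<lambda>n. C * N (y - s n)) \<longlonglongrightarrow> 0" using tendsto_mult_left[OF lim, of C] by simp
  qed
  from tendsto_diff[OF tendsto_const[of "\<psi> y"] this] show ?thesis by simp
qed

text \<open>A functional cuts the dimension by at most one: \<open>T\<close> is spanned by the kernel and any single vector
  of \<open>T\<close> outside of it.\<close>

lemma kernel_infinite_dimensional:
  assumes T: "subspace T" "T \<subseteq> S" and inf: "\<And>B. finite B \<Longrightarrow> \<not> T \<subseteq> span B"
    and \<psi>: "bounded_functional \<psi>" and B: "finite B"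
  shows "\<not> {y \<in> T. \<psi> y = 0} \<subseteq> span B"
proof
  assume ker: "{y \<in> T. \<psi> y = 0} \<subseteq> span B"
  show False
  proof (cases "\<forall>t\<in>T. \<psi> t = 0")
    case True
    then show False using ker inf[OF B] by blast
  next
    case False
    then obtain t where t: "t \<in> T" "\<psi> t \<noteq> 0" by blast
    have "T \<subseteq> span (insert t B)"
    proof
      fix x assume x: "x \<in> T"
      define y where "y = x + scale (- (\<psi> x / \<psi> t)) t"
      have "y \<in> T" unfolding y_def using T(1) x t(1) by (intro subspace_add subspace_scale)
      moreover have "\<psi> y = 0"
      proof -
        have "\<psi> y = \<psi> x + \<psi> (scale (- (\<psi> x / \<psi> t)) t)"
          unfolding y_def using \<psi> x t(1) T subspace_scale[OF T(1) t(1)]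
          unfolding bounded_functional_def by blast
        also have "\<psi> (scale (- (\<psi> x / \<psi> t)) t) = - (\<psi> x / \<psi> t) * \<psi> t"
          using \<psi> t(1) T(2) unfolding bounded_functional_def by blast
        finally show ?thesis using t(2) by simp
      qed
      ultimately have "y \<in> span (insert t B)" using ker span_mono[of B "insert t B"] by blast
      moreover have "x = y + scale (\<psi> x / \<psi> t) t" by (simp add: y_def)
      ultimately show "x \<in> span (insert t B)"
        by (metis insertI1 span_add span_base span_scale)
    qed
    then show False using inf[of "insert t B"] B by simp
  qed
qed

text \<open>Each \<open>x n\<close> is chosen in the common kernel of the earlier functionals, which is still
  infinite-dimensional, and then \<open>f n\<close> is a Hahn--Banach functional for \<open>x n\<close>. Full biorthogonality is not
  achieved in this way, but a triangular matrix of values suffices to compare coefficients one after another.\<close>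

lemma triangular_system:
  assumes inf: "\<And>B. finite B \<Longrightarrow> \<not> S \<subseteq> span B"
  obtains x f where "\<And>n :: nat. x n \<in> S" "\<And>n. N (x n) = 1" "\<And>n. bounded_functional (f n)"
    "\<And>n. f n (x n) = 1" "\<And>m n. n < m \<Longrightarrow> f n (x m) = 0"
proof -
  define big where "big T \<longleftrightarrow> subspace T \<and> T \<subseteq> S \<and> (\<forall>B. finite B \<longrightarrow> \<not> T \<subseteq> span B)" for T
  define P where "P = (\<lambda>(T, x, f). big T \<and> x \<in> T \<and> N x = 1 \<and> bounded_functional f \<and> f x = 1)"
  define step :: "'z set \<times> 'z \<times> ('z \<Rightarrow> 'k) \<Rightarrow> 'z set \<times> 'z \<times> ('z \<Rightarrow> 'k) \<Rightarrow> bool" where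
    "step = (\<lambda>(T, x, f) (T', _). T' = {y \<in> T. f y = 0})"
  have pick: "\<exists>x f. P (T, x, f)" if "big T" for T
  proof -
    have "\<not> T \<subseteq> span {}" using that finite.emptyI unfolding big_def by blast
    then obtain x0 where x0: "x0 \<in> T" "x0 \<noteq> 0" by auto
    then have "x0 \<in> S" using that by (auto simp: big_def)
    then have pos: "N x0 > 0" using N_nonneg N_eq_0 x0(2) by (metis order_le_less)
    define x where "x = scale (of_real (1 / N x0)) x0"
    have x: "x \<in> T" unfolding x_def using that x0(1) by (auto simp: big_def intro: subspace_scale)
    have "N x = 1" unfolding x_def N_scale[OF \<open>x0 \<in> S\<close>] norm_of_real using pos by simp
    moreover from this have "x \<noteq> 0" by auto
    moreover have "x \<in> S" using x that by (auto simp: big_def)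
    moreover obtain f where "bounded_functional f" "f x = 1"
      using exists_functional_eq_1[OF \<open>x \<in> S\<close> \<open>x \<noteq> 0\<close>] .
    ultimately show ?thesis using that x by (auto simp: P_def)
  qed
  have "\<exists>\<tau>. \<forall>n. P (\<tau> n) \<and> step (\<tau> n) (\<tau> (Suc n))"
  proof (rule dependent_nat_choice)
    have "big S" using inf subspace_S by (auto simp: big_def)
    then show "\<exists>\<tau>. P \<tau>" using pick by blast
    fix \<tau> and n :: nat assume \<tau>: "P \<tau>"
    obtain T x f where eq: "\<tau> = (T, x, f)" by (cases \<tau>)
    let ?T = "{y \<in> T. f y = 0}"
    have T: "big T" and f: "bounded_functional f" using \<tau> by (auto simp: P_def eq)
    have "subspace ?T"
      unfolding subspace_def
    proof (intro conjI ballI allI)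
      have "f 0 = 0" using bounded_functional_sum[OF f, of "{}"] by simp
      then show "0 \<in> ?T" using T subspace_0 by (auto simp: big_def)
    qed (use T f in \<open>auto simp: big_def bounded_functional_def subspace_add subspace_scale subset_iff\<close>)
    then have "big ?T"
      using T kernel_infinite_dimensional[OF _ _ _ f, of T] by (auto simp: big_def)
    then show "\<exists>\<tau>'. P \<tau>' \<and> step \<tau> \<tau>'"
      using pick[of ?T] by (auto simp: eq step_def)
  qed
  then obtain \<tau> where \<tau>: "\<forall>n. P (\<tau> n) \<and> step (\<tau> n) (\<tau> (Suc n))" ..
  define T where "T = (\<lambda>n. fst (\<tau> n))"
  define x where "x = (\<lambda>n. fst (snd (\<tau> n)))"
  define f where "f = (\<lambda>n. snd (snd (\<tau> n)))"
  have members: "T n \<subseteq> S" "x n \<in> T n" "N (x n) = 1" "bounded_functional (f n)" "f n (x n) = 1" for n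
    using spec[OF \<tau>, of n] by (auto simp: P_def big_def T_def x_def f_def split: prod.splits)
  have T_Suc: "T (Suc n) = {y \<in> T n. f n y = 0}" for n
    using spec[OF \<tau>, of n] by (auto simp: step_def T_def f_def split: prod.splits)
  have "decseq T" by (rule decseq_SucI) (auto simp: T_Suc)
  show thesis
  proof (rule that)
    show "f n (x m) = 0" if "n < m" for m n
    proof -
      have "x m \<in> T (Suc n)" using members(2)[of m] decseqD[OF \<open>decseq T\<close>, of "Suc n" m] that by auto
      then show ?thesis by (simp add: T_Suc)
    qed
  qed (use members in auto)
qed

text \<open>Let \<open>y t\<close> be the sum of \<open>t^n x n\<close>. By triangularity \<open>f n (y t)\<close> is a polynomial in \<open>t\<close> of degree \<open>n\<close> with
  leading coefficient one. A linear relation with coefficients \<open>c t\<close> between the vectors \<open>y t\<close> therefore makes the power sums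
  of \<open>c\<close> vanish one degree after another, and Vandermonde gives \<open>c = 0\<close>.\<close>

lemma continuum_le_hamel_dim:
  assumes complete: "Metric_space.mcomplete S (norm_dist S N)"
    and inf: "\<And>B. finite B \<Longrightarrow> \<not> S \<subseteq> span B"
  shows "|UNIV :: real set| \<le>o hamel_dim scale S"
proof -
  obtain x f where xS: "\<And>n :: nat. x n \<in> S" and Nx: "\<And>n. N (x n) = 1"
    and f: "\<And>n. bounded_functional (f n)" and diag: "\<And>n. f n (x n) = 1"
    and tri: "\<And>m n. n < m \<Longrightarrow> f n (x m) = 0"
    using triangular_system[OF inf] by blast
  let ?I = "{0<..<1 :: real}"
  have "\<exists>y. y \<in> S \<and> (\<lambda>n. N (y - (\<Sum>k<n. scale (of_real t ^ k) (x k)))) \<longlonglongrightarrow> 0" if t: "t \<in> ?I" for t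
  proof -
    have "summable (\<lambda>k. N (scale (of_real t ^ k) (x k)))"
      using t by (simp add: N_scale xS Nx norm_power summable_geometric)
    from abs_convergent_series[OF complete subspace_scale[OF subspace_S xS] this]
    show ?thesis by metis
  qed
  then have "\<exists>y. \<forall>t\<in>?I. y t \<in> S \<and>
      (\<lambda>n. N (y t - (\<Sum>k<n. scale (of_real t ^ k) (x k)))) \<longlonglongrightarrow> 0"
    by (intro bchoice ballI)
  then obtain y where y: "\<forall>t\<in>?I. y t \<in> S \<and>
      (\<lambda>n. N (y t - (\<Sum>k<n. scale (of_real t ^ k) (x k)))) \<longlonglongrightarrow> 0" ..
  have yS: "y t \<in> S"
    and lim: "(\<lambda>n. N (y t - (\<Sum>k<n. scale (of_real t ^ k) (x k)))) \<longlonglongrightarrow> 0"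
    if "t \<in> ?I" for t
    using bspec[OF y that] by blast+
  have fy: "f n (y t) = (\<Sum>k\<le>n. of_real t ^ k * f n (x k))" if t: "t \<in> ?I" for t n
  proof (rule LIMSEQ_unique)
    show "(\<lambda>m. f n (\<Sum>k<m. scale (of_real t ^ k) (x k))) \<longlonglongrightarrow> f n (y t)"
      by (rule bounded_functional_tendsto[OF f yS[OF t] _ lim[OF t]])
        (intro subspace_sum subspace_scale subspace_S xS)
    have "f n (\<Sum>k<m. scale (of_real t ^ k) (x k)) = (\<Sum>k\<le>n. of_real t ^ k * f n (x k))"
      if "m > n" for m
      unfolding bounded_functional_sum[OF f xS]
      using that tri by (intro sum.mono_neutral_right) auto
    then show "(\<lambda>m. f n (\<Sum>k<m. scale (of_real t ^ k) (x k)))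
        \<longlonglongrightarrow> (\<Sum>k\<le>n. of_real t ^ k * f n (x k))"
      by (intro tendsto_eventually eventually_mono[OF eventually_gt_at_top[of n]])
  qed
  \<comment> \<open>Independence is proved for the family indexed by \<open>t\<close>; injectivity of \<open>y\<close> follows from it.\<close>
  have indep: "c t = 0"
    if F: "finite F" "F \<subseteq> ?I" "(\<Sum>t\<in>F. scale (c t) (y t)) = 0" "t \<in> F" for F c t
  proof (rule eq_0_if_power_sums_eq_0[OF F(1) _ _ F(4)])
    show "inj_on (of_real :: real \<Rightarrow> 'k) F" by (simp add: inj_on_def)
    fix n show "(\<Sum>t\<in>F. c t * of_real t ^ n) = 0"
    proof (induction n rule: less_induct)
      case (less n)
      have "0 = f n (\<Sum>t\<in>F. scale (c t) (y t))"
        unfolding F(3) using bounded_functional_sum[OF f, of "{}"] by simp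
      also have "\<dots> = (\<Sum>t\<in>F. c t * f n (y t))"
        using F(2) yS by (intro bounded_functional_sum[OF f]) auto
      also have "\<dots> = (\<Sum>t\<in>F. c t * (\<Sum>k\<le>n. of_real t ^ k * f n (x k)))"
        using F(2) fy by (intro sum.cong) auto
      also have "\<dots> = (\<Sum>k\<le>n. f n (x k) * (\<Sum>t\<in>F. c t * of_real t ^ k))"
        unfolding sum_distrib_left by (subst sum.swap) (simp add: mult_ac)
      also have "\<dots> = (\<Sum>t\<in>F. c t * of_real t ^ n)"
        using less by (subst sum.remove[of "{..n}" n]) (auto simp: diag intro!: sum.neutral)
      finally show ?case by simp
    qed
  qed
  have inj: "inj_on y ?I"
  proof (rule inj_onI, rule ccontr)
    fix s t assume st: "s \<in> ?I" "t \<in> ?I" "y s = y t" "s \<noteq> t"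
    then have "(\<Sum>r\<in>{s, t}. scale (if r = s then 1 else -1) (y r)) = 0" by simp
    then have "(if s = s then 1 else - 1 :: 'k) = 0" using st by (intro indep[of "{s, t}"]) auto
    then show False by simp
  qed
  have "independent (y ` ?I)"
    unfolding independent_explicit_module
  proof (intro allI impI)
    fix t u v assume t: "finite t" "t \<subseteq> y ` ?I" "(\<Sum>v\<in>t. scale (u v) v) = 0" "v \<in> t"
    then obtain F where F: "F \<subseteq> ?I" "finite F" "t = y ` F"
      using finite_subset_image[OF t(1,2)] by blast
    have "(\<Sum>r\<in>F. scale (u (y r)) (y r)) = 0"
      using t(3) unfolding F(3) by (subst (asm) sum.reindex) (auto intro: inj_on_subset[OF inj F(1)])
    then show "u v = 0" using indep[OF F(2,1), of "\<lambda>r. u (y r)"] t(4) F(3) by auto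
  qed
  then have "|y ` ?I| \<le>o hamel_dim scale S"
    by (rule card_of_independent_le_hamel_dim) (use yS subspace_S in auto)
  moreover have "|UNIV :: real set| \<le>o |y ` ?I|"
  proof -
    \<comment> \<open>The reflected logistic function embeds the real line into the open unit interval.\<close>
    have "inj (\<lambda>r :: real. y (1 / (1 + exp r)))"
    proof (rule injI)
      fix r s :: real assume "y (1 / (1 + exp r)) = y (1 / (1 + exp s))"
      moreover have "1 / (1 + exp r) \<in> ?I" for r :: real
        using exp_gt_zero[of r] by (auto simp: add_pos_pos field_simps)
      ultimately have "1 / (1 + exp r) = 1 / (1 + exp s)" using inj_onD[OF inj] by blast
      then show "r = s" by simp
    qed
    moreover have "range (\<lambda>r :: real. y (1 / (1 + exp r))) \<subseteq> y ` ?I"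
      by (auto simp: add_pos_pos field_simps intro!: imageI)
    ultimately show ?thesis using card_of_ordLeq by blast
  qed
  ultimately show ?thesis by (rule ordLeq_transitive[rotated])
qed

end

section \<open>Rank-one perturbations of a non-injective operator\<close>

context normed_subspace
begin

lemma closedin_norm_topologyI:
  assumes "W \<subseteq> S" and "\<And>x. x \<in> S \<Longrightarrow> (\<And>e. 0 < e \<Longrightarrow> \<exists>w\<in>W. N (x - w) < e) \<Longrightarrow> x \<in> W"
  shows "closedin (norm_topology S N) W"
proof -
  interpret M: Metric_space S "norm_dist S N" by (rule Metric_space_norm_dist)
  have "\<exists>r>0. disjnt W (M.mball x r)" if x: "x \<in> S - W" for x
  proof -
    obtain e where "0 < e" and far: "\<And>w. w \<in> W \<Longrightarrow> \<not> N (x - w) < e"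
      using assms(2)[of x] x by blast
    have "disjnt W (M.mball x e)"
      using far x by (auto simp: disjnt_iff norm_dist_def)
    then show ?thesis using \<open>0 < e\<close> by blast
  qed
  then show ?thesis
    unfolding norm_topology_def M.closedin_metric using assms(1) by blast
qed

lemma cont_lin_opsI:
  fixes scaleV :: "'k \<Rightarrow> 'v::real_normed_vector \<Rightarrow> 'v"
  assumes V: "normed_space_over scaleV" and lin: "Vector_Spaces.linear scaleV scale u"
    and uS: "\<And>v. u v \<in> S" and C: "\<And>v. N (u v) \<le> C * norm v"
  shows "u \<in> cont_lin_ops scaleV scale S N"
proof -
  interpret M: Metric_space S "norm_dist S N" by (rule Metric_space_norm_dist)
  interpret u: Vector_Spaces.linear scaleV scale u by fact
  define D where "D = max C 1"
  have "D > 0" by (simp add: D_def)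
  have "continuous_map euclidean M.mtopology u"
    unfolding M.continuous_map_to_metric
  proof (intro ballI allI impI)
    fix v :: 'v and e :: real assume "0 < e"
    show "\<exists>U. openin euclidean U \<and> v \<in> U \<and> (\<forall>y\<in>U. u y \<in> M.mball (u v) e)"
    proof (intro exI[of _ "ball v (e / D)"] conjI ballI)
      fix w assume w: "w \<in> ball v (e / D)"
      have "N (u v - u w) \<le> C * norm (v - w)" using C[of "v - w"] by (simp add: u.diff)
      also have "\<dots> \<le> D * norm (v - w)" by (intro mult_right_mono) (auto simp: D_def)
      also have "\<dots> < e" using w \<open>D > 0\<close> by (simp add: dist_norm field_simps)
      finally show "u w \<in> M.mball (u v) e" using uS by (simp add: norm_dist_def)
    qed (use \<open>0 < e\<close> \<open>D > 0\<close> in auto)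
  qed
  then show ?thesis using lin uS by (auto simp: cont_lin_ops_def norm_topology_def)
qed

lemma N_apply_le_op_norm:
  fixes scaleV :: "'k \<Rightarrow> 'v::real_normed_vector \<Rightarrow> 'v"
  assumes V: "normed_space_over scaleV" and u: "u \<in> cont_lin_ops scaleV scale S N"
  shows "N (u v) \<le> op_norm N u * norm v"
proof -
  interpret V: normed_space_over scaleV by fact
  interpret u: Vector_Spaces.linear scaleV scale u using u by (simp add: cont_lin_ops_def)
  have uS: "u v \<in> S" for v using u by (auto simp: cont_lin_ops_def)
  obtain C where C: "\<And>v. N (u v) \<le> C * norm v"
    using cont_lin_ops_bounded[OF V normed_subspace_axioms u] by blast
  have "N (u v) \<le> \<bar>C\<bar>" if "norm v \<le> 1" for v
  proof -
    have "N (u v) \<le> \<bar>C\<bar> * norm v" using C[of v] mult_right_mono[OF abs_ge_self[of C], of "norm v"] by simp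
    also have "\<dots> \<le> \<bar>C\<bar>" using that by (intro mult_left_le) auto
    finally show ?thesis .
  qed
  then have "bdd_above ((\<lambda>v. N (u v)) ` {v. norm v \<le> 1})" by (auto simp: bdd_above_def)
  then have upper: "N (u v) \<le> op_norm N u" if "norm v \<le> 1" for v
    unfolding op_norm_def using that by (intro cSUP_upper) auto
  show ?thesis
  proof (cases "v = 0")
    case False
    define w where "w = scaleV (of_real (1 / norm v)) v"
    have "norm w = 1" unfolding w_def V.norm_scale norm_of_real using False by simp
    then have "N (u w) \<le> op_norm N u" using upper by simp
    moreover have "N (u w) = N (u v) / norm v"
      unfolding w_def u.scale N_scale[OF uS] norm_of_real using False by simp
    ultimately show ?thesis using False by (simp add: field_simps)
  qed (simp add: u.zero)
qed

text \<open>The space is \<open>W = {F y a | y \<in> S}\<close> with \<open>F y a = (\<lambda>v. \<phi> v \<cdot> y + a \<cdot> u v)\<close> and \<open>\<phi> = \<psi> \<circ> u\<close>. For closedness,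
  \<open>y\<close> and \<open>a\<close> of this kind must be recovered continuously from \<open>w \<in> W\<close>; suppose \<open>w = F y a\<close>. If there is a point \<open>v2\<close> with \<open>\<phi> v2 = 0\<close> and
  \<open>u v2 \<noteq> 0\<close>, then \<open>w v2 = a \<cdot> u v2\<close>, so a functional \<open>\<theta>\<close> with \<open>\<theta> (u v2) = 1\<close> yields \<open>a\<close>, and then
  \<open>y = w v1 - a \<cdot> u v1\<close>. Otherwise \<open>u = \<phi> \<cdot> u v1\<close> is itself of the form \<open>F y 0\<close>, and \<open>\<theta> = 0\<close> works.
  In both cases \<open>W\<close> is the set of operators \<open>w\<close> with \<open>R w v = 0\<close> for all \<open>v\<close>, where \<open>R w v\<close> is the difference of
  \<open>w v\<close> and the value at \<open>v\<close> of the operator reconstructed from \<open>w\<close>, a continuous function of \<open>w\<close>.\<close>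

lemma rank_one_perturbations:
  fixes scaleV :: "'k \<Rightarrow> 'v::real_normed_vector \<Rightarrow> 'v"
  assumes V: "normed_space_over scaleV"
    and u: "u \<in> noninj_ops scaleV scale S N" "u \<noteq> 0"
  obtains W where "module.subspace (scale_fun scale) W" "u \<in> W"
    "W \<subseteq> noninj_ops scaleV scale S N"
    "closedin (norm_topology (cont_lin_ops scaleV scale S N) (op_norm N)) W"
    "|W| \<le>o |(UNIV :: 'k set) \<times> S|" "hamel_dim scale S \<le>o hamel_dim (scale_fun scale) W"
proof -
  let ?L = "cont_lin_ops scaleV scale S N"
  interpret V: normed_space_over scaleV by fact
  interpret u: Vector_Spaces.linear scaleV scale u
    using u by (simp add: noninj_ops_def cont_lin_ops_def)
  interpret L: normed_subspace "scale_fun scale :: 'k \<Rightarrow> ('v \<Rightarrow> 'z) \<Rightarrow> 'v \<Rightarrow> 'z" ?L "op_norm N"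
    by (rule normed_subspace_cont_lin_ops[OF V normed_subspace_axioms])
  have uL: "u \<in> ?L" using u by (simp add: noninj_ops_def)
  have LS: "w v \<in> S" if "w \<in> ?L" for w v using that by (auto simp: cont_lin_ops_def)
  note uS = LS[OF uL]
  note S_intros = subspace_add[OF subspace_S] subspace_diff[OF subspace_S]
    subspace_scale[OF subspace_S] subspace_0[OF subspace_S]
  obtain v0 where v0: "v0 \<noteq> 0" "u v0 = 0"
  proof -
    obtain a b where "u a = u b" "a \<noteq> b" using u by (auto simp: noninj_ops_def inj_def)
    then show thesis using that[of "a - b"] by (simp add: u.diff)
  qed
  obtain v1 where v1: "u v1 \<noteq> 0" using u(2) by (auto simp: fun_eq_iff)
  obtain \<psi> where \<psi>: "bounded_functional \<psi>" "\<psi> (u v1) = 1"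
    using exists_functional_eq_1[OF uS v1] .
  define \<phi> where "\<phi> v = \<psi> (u v)" for v
  have \<phi>_add: "\<phi> (v + w) = \<phi> v + \<phi> w" and \<phi>_scale: "\<phi> (scaleV a v) = a * \<phi> v" for v w a
    using \<psi>(1) uS by (simp_all add: \<phi>_def u.add u.scale bounded_functional_def)
  have \<phi>0: "\<phi> 0 = 0" using \<phi>_scale[of 0 0] by simp
  have \<phi>v1: "\<phi> v1 = 1" by (simp add: \<phi>_def \<psi>(2))
  have \<phi>v0: "\<phi> v0 = 0" using \<phi>0 by (simp add: \<phi>_def v0 u.zero)
  obtain D where D: "\<And>v. norm (\<phi> v) \<le> D * norm v"
  proof -
    obtain C where C: "0 \<le> C" "\<And>x. x \<in> S \<Longrightarrow> norm (\<psi> x) \<le> C * N x"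
      using bounded_functional_bound[OF \<psi>(1)] by blast
    have "norm (\<phi> v) \<le> (C * op_norm N u) * norm v" for v
      using C(2)[OF uS, of v] mult_left_mono[OF N_apply_le_op_norm[OF V uL, of v] C(1)]
      by (simp add: \<phi>_def mult.assoc)
    then show thesis by (rule that)
  qed
  define F where "F y a v = scale (\<phi> v) y + scale a (u v)" for y a v
  define W where "W = (\<lambda>(a, y). F y a) ` (UNIV \<times> S)"
  have WI: "F y a \<in> W" if "y \<in> S" for y a using that by (auto simp: W_def)
  have FL: "F y a \<in> ?L" if y: "y \<in> S" for y a
  proof (rule cont_lin_opsI[OF V])
    show "Vector_Spaces.linear scaleV scale (F y a)"
      by unfold_locales
        (simp_all add: F_def \<phi>_add \<phi>_scale u.add u.scale scale_left_distrib scale_right_distrib mult.commute)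
    show FS: "F y a v \<in> S" for v unfolding F_def by (intro S_intros y uS)
    show "N (F y a v) \<le> (D * N y + norm a * op_norm N u) * norm v" for v
    proof -
      have "N (F y a v) \<le> N (scale (\<phi> v) y) + N (scale a (u v))"
        unfolding F_def by (intro N_triangle S_intros y uS)
      also have "\<dots> = norm (\<phi> v) * N y + norm a * N (u v)" by (simp add: N_scale y uS)
      also have "\<dots> \<le> (D * norm v) * N y + norm a * (op_norm N u * norm v)"
        by (intro add_mono mult_mono mult_left_mono D N_apply_le_op_norm[OF V uL] N_nonneg y uS
            norm_ge_zero order_refl order_trans[OF norm_ge_zero D])
      finally show ?thesis by (simp add: algebra_simps)
    qed
  qed
  show thesis
  proof (rule that)
    show "L.subspace W"
      unfolding L.subspace_def
    proof (intro conjI ballI allI)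
      have "0 = F 0 0" by (simp add: F_def fun_eq_iff)
      then show "0 \<in> W" using WI[of 0 0] S_intros(4) by simp
      fix w assume "w \<in> W"
      then obtain y a where w: "y \<in> S" "w = F y a" by (auto simp: W_def)
      have "scale_fun scale b w = F (scale b y) (b * a)" for b
        by (simp add: w F_def fun_eq_iff scale_fun_def scale_right_distrib mult.commute)
      then show "scale_fun scale b w \<in> W" for b using WI S_intros(3) w(1) by simp
      fix w' assume "w' \<in> W"
      then obtain y' a' where w': "y' \<in> S" "w' = F y' a'" by (auto simp: W_def)
      have "w + w' = F (y + y') (a + a')"
        by (simp add: w w' F_def fun_eq_iff algebra_simps)
      then show "w + w' \<in> W" using WI S_intros(1) w(1) w'(1) by simp
    qed
    have "u = F 0 1" by (simp add: F_def fun_eq_iff)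
    then show "u \<in> W" using WI[of 0 1] S_intros(4) by simp
    have "F y a v0 = F y a 0" for y a by (simp add: F_def \<phi>v0 \<phi>0 v0 u.zero)
    then have "\<not> inj (F y a)" for y a using v0(1) by (metis injD)
    then show "W \<subseteq> noninj_ops scaleV scale S N" using FL by (auto simp: W_def noninj_ops_def)
    show "|W| \<le>o |(UNIV :: 'k set) \<times> S|" unfolding W_def by (rule card_of_image)
    interpret P: vector_space_pair scale "scale_fun scale :: 'k \<Rightarrow> ('v \<Rightarrow> 'z) \<Rightarrow> 'v \<Rightarrow> 'z" ..
    show "hamel_dim scale S \<le>o hamel_dim (scale_fun scale) W"
    proof (rule P.hamel_dim_le_of_inj_on[of "\<lambda>y. F y 0"])
      show "Vector_Spaces.linear scale (scale_fun scale) (\<lambda>y. F y 0)"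
        by unfold_locales (simp_all add: F_def fun_eq_iff scale_fun_def algebra_simps)
      have "F y 0 v1 = y" for y by (simp add: F_def \<phi>v1)
      then show "inj_on (\<lambda>y. F y 0) S" by (metis inj_onI)
      show "(\<lambda>y. F y 0) ` S \<subseteq> W" using WI by blast
      show "L.subspace W" by fact
    qed (rule subspace_S)
    obtain v2 \<theta> where \<theta>: "bounded_functional \<theta>"
      and rec: "\<And>y a v. y \<in> S \<Longrightarrow>
        F y a v = F (F y a v1 - scale (\<theta> (F y a v2)) (u v1)) (\<theta> (F y a v2)) v"
    proof (cases "\<exists>v2. \<phi> v2 = 0 \<and> u v2 \<noteq> 0")
      case True
      then obtain v2 where v2: "\<phi> v2 = 0" "u v2 \<noteq> 0" by blast
      obtain \<theta> where \<theta>: "bounded_functional \<theta>" "\<theta> (u v2) = 1"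
        using exists_functional_eq_1[OF uS v2(2)] .
      have "\<theta> (F y a v2) = a" for y a
        using \<theta> uS by (simp add: F_def v2 bounded_functional_def)
      then show thesis using that[OF \<theta>(1), of v2] by (simp add: F_def \<phi>v1)
    next
      case False
      have uv: "u v = scale (\<phi> v) (u v1)" for v
      proof -
        have "\<phi> (v + scaleV (- \<phi> v) v1) = 0" by (simp add: \<phi>_add \<phi>_scale \<phi>v1 del: V.scale_minus_left)
        then have "u (v + scaleV (- \<phi> v) v1) = 0" using False by blast
        then show ?thesis by (simp add: u.diff u.scale)
      qed
      have "bounded_functional (\<lambda>_. 0)"
        using N_nonneg by (auto simp: bounded_functional_def intro: exI[of _ 0])
      moreover have "F y a v = F (F y a v1) 0 v" for y a v
        by (simp add: F_def \<phi>v1 uv[of v] scale_right_distrib mult.commute)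
      ultimately show thesis using that[of "\<lambda>_. 0" v1] by simp
    qed
    obtain C where C: "0 \<le> C" "\<And>x. x \<in> S \<Longrightarrow> norm (\<theta> x) \<le> C * N x"
      using bounded_functional_bound[OF \<theta>] by blast
    define R where "R w v = w v - F (w v1 - scale (\<theta> (w v2)) (u v1)) (\<theta> (w v2)) v" for w v
    define K where "K v = norm v + norm (\<phi> v) * (norm v1 + C * norm v2 * N (u v1)) + C * norm v2 * N (u v)" for v
    have R_bound: "N (R w v) \<le> K v * op_norm N w" if w: "w \<in> ?L" for w v
    proof -
      let ?c = "\<theta> (w v2)"
      note wS = LS[OF w]
      have le: "N (w v) \<le> op_norm N w * norm v" for v by (rule N_apply_le_op_norm[OF V w])
      have c: "norm ?c \<le> C * (op_norm N w * norm v2)"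
        using C(2)[OF wS, of v2] mult_left_mono[OF le[of v2] C(1)] by simp
      have "N (R w v) \<le> N (w v) + N (F (w v1 - scale ?c (u v1)) ?c v)"
      proof -
        have "R w v = w v + scale (-1) (F (w v1 - scale ?c (u v1)) ?c v)" by (simp add: R_def)
        moreover have "F (w v1 - scale ?c (u v1)) ?c v \<in> S"
          unfolding F_def by (intro S_intros wS uS)
        ultimately show ?thesis
          using N_triangle[OF wS[of v] S_intros(3), of _ "-1"] N_scale[of _ "-1"] by fastforce
      qed
      also have "N (F (w v1 - scale ?c (u v1)) ?c v)
          \<le> N (scale (\<phi> v) (w v1 - scale ?c (u v1))) + N (scale ?c (u v))"
        unfolding F_def by (intro N_triangle S_intros wS uS)
      also have "\<dots> = norm (\<phi> v) * N (w v1 - scale ?c (u v1)) + norm ?c * N (u v)"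
        by (simp add: N_scale S_intros wS uS)
      also have "N (w v1 - scale ?c (u v1)) \<le> N (w v1) + norm ?c * N (u v1)"
        using N_triangle[OF wS[of v1] S_intros(3)[OF uS[of v1], of "- ?c"]]
        by (simp add: N_scale S_intros uS del: scale_minus_left) simp
      also have "N (w v) + (norm (\<phi> v) * (N (w v1) + norm ?c * N (u v1)) + norm ?c * N (u v))
          \<le> op_norm N w * norm v + (norm (\<phi> v) * (op_norm N w * norm v1
              + C * (op_norm N w * norm v2) * N (u v1)) + C * (op_norm N w * norm v2) * N (u v))"
        by (intro add_mono mult_left_mono mult_right_mono le c N_nonneg uS norm_ge_zero)
      also have "\<dots> = K v * op_norm N w" by (simp add: K_def algebra_simps)
      finally show ?thesis by (simp add: mult_left_mono)
    qed
    have R_diff: "R (w - w') v = R w v - R w' v" if "w \<in> ?L" "w' \<in> ?L" for w w' v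
      using that by (simp add: R_def F_def bounded_functional_diff[OF \<theta>] LS algebra_simps)
    show "closedin (norm_topology ?L (op_norm N)) W"
    proof (rule L.closedin_norm_topologyI)
      show "W \<subseteq> ?L" using FL by (auto simp: W_def)
      fix x assume x: "x \<in> ?L" and near: "\<And>e. 0 < e \<Longrightarrow> \<exists>w\<in>W. op_norm N (x - w) < e"
      have "R x v = 0" for v
      proof -
        have RS: "R x v \<in> S" unfolding R_def F_def by (intro S_intros LS[OF x] uS)
        have "K v \<ge> 0" unfolding K_def using C(1) N_nonneg[OF uS] by (intro add_nonneg_nonneg mult_nonneg_nonneg) auto
        have "N (R x v) \<le> e" if "0 < e" for e
        proof -
          obtain w where w: "w \<in> W" "op_norm N (x - w) < e / (K v + 1)"
            using near[of "e / (K v + 1)"] \<open>0 < e\<close> \<open>K v \<ge> 0\<close> by auto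
          have wL: "w \<in> ?L" using w(1) FL by (auto simp: W_def)
          have "R w v = 0" using w(1) rec by (auto simp: W_def R_def)
          then have "N (R x v) = N (R (x - w) v)" using R_diff[OF x wL] by simp
          also have "\<dots> \<le> K v * op_norm N (x - w)"
            by (rule R_bound[OF L.subspace_diff[OF L.subspace_S x wL]])
          also have "\<dots> \<le> K v * (e / (K v + 1))"
            using w(2) \<open>K v \<ge> 0\<close> by (intro mult_left_mono) auto
          also have "\<dots> \<le> e" using \<open>K v \<ge> 0\<close> \<open>0 < e\<close> by (simp add: field_simps)
          finally show ?thesis .
        qed
        then have "N (R x v) \<le> 0" by (rule field_le_epsilon[of _ 0, simplified])
        then show ?thesis using N_nonneg[OF RS] N_eq_0[OF RS] by simp
      qed
      define a y where "a = \<theta> (x v2)" and "y = x v1 - scale a (u v1)"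
      have "x = F y a"
        unfolding y_def a_def
        using \<open>\<And>v. R x v = 0\<close> unfolding R_def by - (rule ext, rule right_minus_eq[THEN iffD1])
      moreover have "F y a \<in> W"
        unfolding y_def by (intro WI S_intros LS[OF x] uS)
      ultimately show "x \<in> W" by simp
    qed
  qed
qed

end

section \<open>Spaceability\<close>

context banach_sequence_space
begin

text \<open>The vectors \<open>single n x\<close> with the only nonzero entry \<open>x\<close> in position \<open>n\<close> lie in \<open>c00\<close>. For \<open>n = 0\<close> they form
  a linear copy of \<open>X\<close>; for a fixed \<open>x \<noteq> 0\<close> they are linearly independent, so \<open>E\<close> is
  infinite-dimensional and its completeness yields the continuum.\<close>

lemma card_max_le_hamel_dim:
  assumes c00: "c00 \<subseteq> E" and nontrivial: "\<exists>x :: 'x. x \<noteq> 0"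
  shows "card_max |UNIV :: real set| (hamel_dim scaleX UNIV) \<le>o hamel_dim (scale_fun scaleX) E"
proof (rule card_max_least)
  interpret X: normed_space_over scaleX by (rule normed_X)
  obtain x0 :: 'x where x0: "x0 \<noteq> 0" using nontrivial by blast
  define single where "single n x j = (if j = n then x else 0)" for n j :: nat and x :: 'x
  have single_E: "single n x \<in> E" for n x
    using c00 by (auto simp: c00_def single_def subset_iff)
  show "Card_order |UNIV :: real set|" "Card_order (hamel_dim scaleX UNIV)"
    by (rule card_of_Card_order Card_order_hamel_dim)+
  interpret P: vector_space_pair scaleX "scale_fun scaleX :: 'k \<Rightarrow> (nat \<Rightarrow> 'x) \<Rightarrow> nat \<Rightarrow> 'x" ..
  show "hamel_dim scaleX UNIV \<le>o hamel_dim (scale_fun scaleX) E"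
  proof (rule P.hamel_dim_le_of_inj_on[of "single 0"])
    show "Vector_Spaces.linear scaleX (scale_fun scaleX) (single 0)"
      by unfold_locales (simp_all add: single_def fun_eq_iff scale_fun_def)
    show "inj_on (single 0) UNIV"
      by (rule inj_onI) (metis single_def)
  qed (use single_E subspace_S in \<open>auto simp: X.subspace_UNIV\<close>)
  show "|UNIV :: real set| \<le>o hamel_dim (scale_fun scaleX) E"
  proof (rule continuum_le_hamel_dim[OF complete_E])
    have inj: "inj (\<lambda>n. single n x0)"
      using x0 by (auto simp: inj_def single_def fun_eq_iff split: if_splits)
    have "independent (range (\<lambda>n. single n x0))"
      unfolding dependent_def
    proof (intro notI, elim bexE rangeE)
      fix a n assume a: "a \<in> span (range (\<lambda>n. single n x0) - {a})" "a = single n x0"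
      have "range (\<lambda>n. single n x0) - {a} \<subseteq> {y. y n = 0}" using a(2) by (auto simp: single_def)
      moreover have "subspace {y :: nat \<Rightarrow> 'x. y n = 0}"
        by (auto simp: subspace_def scale_fun_def)
      ultimately have "span (range (\<lambda>n. single n x0) - {a}) \<subseteq> {y. y n = 0}" by (rule span_minimal)
      then have "a n = 0" using a(1) by blast
      then show False using a(2) x0 by (simp add: single_def)
    qed
    moreover have "infinite (range (\<lambda>n. single n x0))" using inj by (simp add: finite_image_iff)
    moreover have "range (\<lambda>n. single n x0) \<subseteq> E" using single_E by auto
    ultimately show "\<not> E \<subseteq> span B" if "finite B" for B
      using independent_span_bound[OF that] by blast
  qed
qed

end

theorem theorem4p1:
  fixes scaleV :: "'k::real_or_complex \<Rightarrow> 'v::real_normed_vector \<Rightarrow> 'v"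
    and scaleX :: "'k \<Rightarrow> 'x::banach \<Rightarrow> 'x"
    and E :: "(nat \<Rightarrow> 'x) set"
    and normE :: "(nat \<Rightarrow> 'x) \<Rightarrow> real"
  assumes "normed_space_over scaleV" and "\<exists>v :: 'v. v \<noteq> 0"
    and "normed_space_over scaleX" and "\<exists>x :: 'x. x \<noteq> 0"
    and "banach_sequence_space scaleX E normE"
    and "c00 \<subseteq> E"
    and "noninj_ops scaleV (scale_fun scaleX) E normE \<noteq> {0}"
  shows "spaceable (scale_fun (scale_fun scaleX))
           (cont_lin_ops scaleV (scale_fun scaleX) E normE)
           (norm_topology (cont_lin_ops scaleV (scale_fun scaleX) E normE) (op_norm normE))
           BNF_Cardinal_Arithmetic.cone
           (card_max |UNIV :: real set| (hamel_dim scaleX UNIV))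
           (noninj_ops scaleV (scale_fun scaleX) E normE)"
proof -
  interpret E: banach_sequence_space scaleX E normE by fact
  let ?L = "cont_lin_ops scaleV (scale_fun scaleX) E normE"
  let ?A = "noninj_ops scaleV (scale_fun scaleX) E normE"
  let ?\<beta> = "card_max |UNIV :: real set| (hamel_dim scaleX UNIV)"
  interpret L: normed_subspace "scale_fun (scale_fun scaleX)" ?L "op_norm normE"
    by (rule normed_subspace_cont_lin_ops[OF assms(1) E.normed_subspace_axioms])
  have Card: "Card_order ?\<beta>" by (rule Card_order_card_max)
  have real: "|UNIV :: real set| \<le>o ?\<beta>"
    by (rule card_max_upper[OF card_of_Card_order Card_order_hamel_dim])
  have inf: "infinite (Field ?\<beta>)" by (rule infinite_Field_if_continuum_le[OF Card real])
  \<comment> \<open>This serves twice: it extends a given line, and it shows that the space of operators itself has dimension at least \<open>?\<beta>\<close>.\<close>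
  have extend: "\<exists>W. L.subspace W \<and> W \<subseteq> ?L \<and> closedin (norm_topology ?L (op_norm normE)) W \<and>
      hamel_dim (scale_fun (scale_fun scaleX)) W =o ?\<beta> \<and> u \<in> W \<and> W \<subseteq> ?A"
    if u: "u \<in> ?A" "u \<noteq> 0" for u
  proof -
    obtain W where W: "L.subspace W" "u \<in> W" "W \<subseteq> ?A"
      "closedin (norm_topology ?L (op_norm normE)) W"
      "|W| \<le>o |(UNIV :: 'k set) \<times> E|"
      "hamel_dim (scale_fun scaleX) E \<le>o hamel_dim (scale_fun (scale_fun scaleX)) W"
      using E.rank_one_perturbations[OF assms(1) u] .
    have "|E| \<le>o ?\<beta>"
      by (rule ordLeq_transitive[OF card_of_sequence_space_le card_of_banach_space_le[OF assms(3)]])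
    then have "|(UNIV :: 'k set) \<times> E| \<le>o ?\<beta>"
      using ordLeq_transitive[OF card_of_scalars real] inf Card
      by (intro card_of_Times_ordLeq_infinite_Field)
    then have "hamel_dim (scale_fun (scale_fun scaleX)) W \<le>o ?\<beta>"
      by (rule ordLeq_transitive[OF ordLeq_transitive[OF L.hamel_dim_le_card_of[OF W(1)] W(5)]])
    moreover have "?\<beta> \<le>o hamel_dim (scale_fun (scale_fun scaleX)) W"
      by (rule ordLeq_transitive[OF E.card_max_le_hamel_dim[OF assms(6,4)] W(6)])
    ultimately have "hamel_dim (scale_fun (scale_fun scaleX)) W =o ?\<beta>"
      by (simp add: ordIso_iff_ordLeq)
    moreover have "W \<subseteq> ?L" using W(3) by (auto simp: noninj_ops_def)
    ultimately show ?thesis using W by blast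
  qed
  obtain v :: 'v where "v \<noteq> 0" using assms(2) by blast
  then have "\<not> inj (0 :: 'v \<Rightarrow> nat \<Rightarrow> 'x)" by (auto simp: inj_def)
  then have "0 \<in> ?A" using L.subspace_0[OF L.subspace_S] by (simp add: noninj_ops_def)
  then obtain u where u: "u \<in> ?A" "u \<noteq> 0" using assms(7) by blast
  obtain W0 where W0: "L.subspace W0" "W0 \<subseteq> ?L" "hamel_dim (scale_fun (scale_fun scaleX)) W0 =o ?\<beta>"
    using extend[OF u] by blast
  show ?thesis
    unfolding spaceable_def
  proof (intro conjI allI impI)
    show "Card_order BNF_Cardinal_Arithmetic.cone" by (rule Card_order_cone)
    show "Card_order ?\<beta>" by fact
    have "finite (Field BNF_Cardinal_Arithmetic.cone)"
      by (simp add: BNF_Cardinal_Arithmetic.cone_def Field_card_of)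
    then show "BNF_Cardinal_Arithmetic.cone <o ?\<beta>"
      by (rule finite_ordLess_infinite[OF card_order_on_well_order_on[OF Card_order_cone]
            card_order_on_well_order_on[OF Card] _ inf])
    show "?\<beta> \<le>o hamel_dim (scale_fun (scale_fun scaleX)) ?L"
      by (rule ordIso_ordLeq_trans[OF ordIso_symmetric[OF W0(3)]
            L.hamel_dim_mono[OF W0(1) L.subspace_S W0(2)]])
    show "?A \<subseteq> ?L" by (auto simp: noninj_ops_def)
    fix W assume W: "L.subspace W \<and> W \<subseteq> ?L \<and>
      hamel_dim (scale_fun (scale_fun scaleX)) W =o BNF_Cardinal_Arithmetic.cone \<and> W \<subseteq> ?A \<union> {0}"
    then obtain w where w: "w \<in> W" "w \<noteq> 0" "W = L.span {w}"
      using L.subspace_of_dimension_one by metis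
    then have "w \<in> ?A" using W by blast
    from extend[OF this w(2)] obtain W' where W': "L.subspace W'" "W' \<subseteq> ?L"
      "closedin (norm_topology ?L (op_norm normE)) W'"
      "hamel_dim (scale_fun (scale_fun scaleX)) W' =o ?\<beta>" "w \<in> W'" "W' \<subseteq> ?A" by blast
    have "W \<subseteq> W'" unfolding w(3) using W'(1,5) by (intro L.span_minimal) auto
    then show "\<exists>W'. L.subspace W' \<and> W' \<subseteq> ?L \<and> closedin (norm_topology ?L (op_norm normE)) W' \<and>
        hamel_dim (scale_fun (scale_fun scaleX)) W' =o ?\<beta> \<and> W \<subseteq> W' \<and> W' \<subseteq> ?A \<union> {0}"
      using W' by blast
  qed
qed

end
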